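(* Let $S$ be a minimal Lorentzian surface of general type in $\mathbb{R}^4_2$ parametrized by $\Psi(u,v)=\beta(u+v)+\theta(u-v)$, such that the null curves $\beta$ and $\theta$ satisfy $$\beta'(t)=f_1(t)\big(1+g_1(t)h_1(t),\ g_1(t)-h_1(t),\ 1-g_1(t)h_1(t),\ g_1(t)+h_1(t)\big),$$ $$\theta'(s)=f_2(s)\big(1+g_2(s)h_2(s),\ g_2(s)-h_2(s),\ 1-g_2(s)h_2(s),\ g_2(s)+h_2(s)\big),$$ where $f_i,g_i,h_i$ are smooth real functions of one variable with $f_1f_2(g_1-g_2)(h_1-h_2)\neq 0$ and $g_1'g_2'h_1'h_2'>0$ (functions with index $1$ evaluated at $t=u+v$, functions with index $2$ at $s=u-v$). Then $S$ has a canonical representation $$\overline\Psi(\bar u,\bar v)=\bar\beta(\bar u+\bar v)+\bar\theta(\bar u-\bar v),$$ that is, a representation in canonical parameters $(\bar u,\bar v)$, where $\bar\beta$ and $\bar\theta$ are null curves satisfying $$\bar\beta'(z)=\frac{1}{4\sqrt{|\bar g_1'(z)\bar h_1'(z)|}}\big(1+\bar g_1(z)\bar h_1(z),\ \bar g_1(z)-\bar h_1(z),\ 1-\bar g_1(z)\bar h_1(z),\ \bar g_1(z)+\bar h_1(z)\big),$$ $$\bar\theta'(z)=\frac{1}{4\sqrt{|\bar g_2'(z)\bar h_2'(z)|}}\big(1+\bar g_2(z)\bar h_2(z),\ \bar g_2(z)-\bar h_2(z),\ 1-\bar g_2(z)\bar h_2(z),\ \bar g_2(z)+\bar h_2(z)\big).$$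 This canonical representation is determined by the equations $$(p'(z))^2=\frac{1}{8\,|f_1(p(z))|\sqrt{|g_1'(p(z))h_1'(p(z))|}},\quad \bar g_1(z)=g_1(p(z)),\ \ \bar h_1(z)=h_1(p(z)),$$ $$(q'(z))^2=\frac{1}{8\,|f_2(q(z))|\sqrt{|g_2'(q(z))h_2'(q(z))|}},\quad \bar g_2(z)=g_2(q(z)),\ \ \bar h_2(z)=h_2(q(z)),$$ where $p,q$ are the functions of one variable giving the change of parameters $$u=p(\bar u+\bar v)+q(\bar u-\bar v),\qquad v=p(\bar u+\bar v)-q(\bar u-\bar v),$$ by which $\overline\Psi$ is obtained from $\Psi$, i.e. $\overline\Psi(\bar u,\bar v)=\Psi\big(p(\bar u+\bar v)+q(\bar u-\bar v),\,p(\bar u+\bar v)-q(\bar u-\bar v)\big)$.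
   Context: $\mathbb{R}^4_2$ is $\mathbb{R}^4$ with the flat metric $\langle X,Y\rangle=X_1Y_1+X_2Y_2-X_3Y_3-X_4Y_4$. A null curve is a smooth curve $\beta$ with $\beta'\neq0$, $\langle\beta',\beta'\rangle=0$. A Lorentzian surface is a smooth immersed surface whose induced metric has signature $(1,1)$; it is minimal if its mean curvature vector vanishes. Let $\sigma$ be its second fundamental form. The first normal space at a point is the span of the values of $\sigma$. For an orthonormal tangent frame $\langle x,x\rangle=1$, $\langle y,y\rangle=-1$, $\langle x,y\rangle=0$ and an orthonormal normal frame $\langle e_1,e_1\rangle=1$, $\langle e_2,e_2\rangle=-1$, $\langle e_1,e_2\rangle=0$, minimality gives $\sigma(x,x)=\sigma(y,y)=ae_1+be_2$, and one writes $\sigma(x,y)=ce_1+de_2$; then the Gauss curvature is $K=b^2-a^2+c^2-d^2$ and the normal curvature (curvature of the normal connection) is $\varkappa=2(bc-ad)$. A minimal Lorentzian surface is of general type if at every point its first normal space is two-dimensional and $K^2-\varkappa^2>0$. Canonical parameters: for a parametrization $\Psi(u,v)$ put $E=\langle\Psi_u,\Psi_u\rangle$, $F=\langle\Psi_u,\Psi_v\rangle$, $G=\langle\Psi_v,\Psi_v\rangle$. The parameters are isothermal if $E=-G$, $F=0$; one writes $E=f^2$, $G=-f^2$ with a positive function $f$, and $x=\Psi_u/f$, $y=\Psi_v/f$, so that $\langle x,x\rangle=1$, $\langle y,y\rangle=-1$, $\langle x,y\rangle=0$. On a minimal Lorentzian surface of general type there is locally an orthonormal frame $\{x,y,n_1,n_2\}$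 with $x,y$ tangent, $n_1,n_2$ normal, $\langle x,x\rangle=1$, $\langle y,y\rangle=-1$, $\langle n_1,n_1\rangle=\varepsilon$, $\langle n_2,n_2\rangle=-\varepsilon$ ($\varepsilon=\pm1$), such that $\sigma(x,x)=\sigma(y,y)=\nu n_1$, $\sigma(x,y)=\mu n_2$ with $\nu\mu$ nowhere zero; the directions of these $x,y$ are called canonical directions, and $K^2-\varkappa^2=(\mu^2-\nu^2)^2$. Parameters $(u,v)$ are canonical if they are isothermal, $\Psi_u$ and $\Psi_v$ point in the canonical directions of $x$ and $y$ respectively, and $E^2=G^2=\frac{1}{|\mu^2-\nu^2|}$.
   Formalization: Corrected: since u+v=2p and u-v=2q, the equations evaluate f_i, g_i, h_i at 2p(z), 2q(z), the constant 8 becomes 16, and p'f_1>0, q'f_2>0 fix the signs; if E<0 in the displayed form, the new parameters are canonical in the order (v-bar, u-bar). *)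

theory Defs
  imports "HOL-Analysis.Analysis"
begin

section \<open>Smooth maps\<close>

fun times_differentiable_on ::
    "'a::real_normed_vector set \<Rightarrow> ('a \<Rightarrow> 'b::real_normed_vector) \<Rightarrow> nat \<Rightarrow> bool" where
  "times_differentiable_on S f 0 \<longleftrightarrow> continuous_on S f"
| "times_differentiable_on S f (Suc n) \<longleftrightarrow>
     (\<forall>x\<in>S. f differentiable (at x)) \<and>
     (\<forall>v. times_differentiable_on S (\<lambda>x. frechet_derivative f (at x) v) n)"

text \<open>Only used for open sets.\<close>

definition smooth_on ::
    "'a::real_normed_vector set \<Rightarrow> ('a \<Rightarrow> 'b::real_normed_vector) \<Rightarrow> bool" where
  "smooth_on S f \<longleftrightarrow> (\<forall>n. times_differentiable_on S f n)"

section \<open>The space \<open>R^4_2\<close> and its null curves\<close>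

definition scal :: "real^4 \<Rightarrow> real^4 \<Rightarrow> real" where
  "scal X Y = X$1 * Y$1 + X$2 * Y$2 - X$3 * Y$3 - X$4 * Y$4"

definition null_curve :: "real set \<Rightarrow> (real \<Rightarrow> real^4) \<Rightarrow> bool" where
  "null_curve I \<beta> \<longleftrightarrow> smooth_on I \<beta> \<and>
     (\<forall>t\<in>I. vector_derivative \<beta> (at t) \<noteq> 0 \<and>
            scal (vector_derivative \<beta> (at t)) (vector_derivative \<beta> (at t)) = 0)"

definition null_vec :: "real \<Rightarrow> real \<Rightarrow> real^4" where
  "null_vec g h = vector [1 + g * h, g - h, 1 - g * h, g + h]"

section \<open>Parametrized surfaces\<close>

text \<open>A surface is a map \<open>\<Psi>\<close> on an open subset of the plane.  Tangent vectors at \<open>\<Psi> p\<close> are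
  \<open>dmap \<Psi> p \<xi>\<close> for \<open>\<xi>\<close> in the plane, and they enter the forms below through \<open>\<xi>\<close>;
  thus \<open>(1, 0)\<close> stands for \<open>\<Psi>\<^sub>u\<close> and \<open>(0, 1)\<close> for \<open>\<Psi>\<^sub>v\<close>.\<close>

type_synonym surface = "real \<times> real \<Rightarrow> real^4"

definition dmap :: "surface \<Rightarrow> real \<times> real \<Rightarrow> real \<times> real \<Rightarrow> real^4" where
  "dmap \<Psi> p \<xi> = frechet_derivative \<Psi> (at p) \<xi>"

definition first_form :: "surface \<Rightarrow> real \<times> real \<Rightarrow> real \<times> real \<Rightarrow> real \<times> real \<Rightarrow> real" where
  "first_form \<Psi> p \<xi> \<eta> = scal (dmap \<Psi> p \<xi>) (dmap \<Psi> p \<eta>)"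

definition coefE :: "surface \<Rightarrow> real \<times> real \<Rightarrow> real" where
  "coefE \<Psi> p = first_form \<Psi> p (1, 0) (1, 0)"

definition coefF :: "surface \<Rightarrow> real \<times> real \<Rightarrow> real" where
  "coefF \<Psi> p = first_form \<Psi> p (1, 0) (0, 1)"

definition coefG :: "surface \<Rightarrow> real \<times> real \<Rightarrow> real" where
  "coefG \<Psi> p = first_form \<Psi> p (0, 1) (0, 1)"

definition normal_space :: "surface \<Rightarrow> real \<times> real \<Rightarrow> (real^4) set" where
  "normal_space \<Psi> p = {n. \<forall>\<xi>. scal n (dmap \<Psi> p \<xi>) = 0}"

text \<open>Well defined wherever the induced metric is nondegenerate.\<close>

definition normal_part :: "surface \<Rightarrow> real \<times> real \<Rightarrow> real^4 \<Rightarrow> real^4" where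
  "normal_part \<Psi> p w = (THE n. n \<in> normal_space \<Psi> p \<and> w - n \<in> range (dmap \<Psi> p))"

definition second_form :: "surface \<Rightarrow> real \<times> real \<Rightarrow> real \<times> real \<Rightarrow> real \<times> real \<Rightarrow> real^4" where
  "second_form \<Psi> p \<xi> \<eta> =
     normal_part \<Psi> p (frechet_derivative (\<lambda>q. dmap \<Psi> q \<xi>) (at p) \<eta>)"

definition tangent_frame :: "surface \<Rightarrow> real \<times> real \<Rightarrow> real \<times> real \<Rightarrow> real \<times> real \<Rightarrow> bool" where
  "tangent_frame \<Psi> p x y \<longleftrightarrow>
     first_form \<Psi> p x x = 1 \<and> first_form \<Psi> p y y = -1 \<and> first_form \<Psi> p x y = 0"

definition normal_frame :: "surface \<Rightarrow> real \<times> real \<Rightarrow> real \<Rightarrow> real^4 \<Rightarrow> real^4 \<Rightarrow> bool" where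
  "normal_frame \<Psi> p \<epsilon> n1 n2 \<longleftrightarrow> n1 \<in> normal_space \<Psi> p \<and> n2 \<in> normal_space \<Psi> p \<and>
     scal n1 n1 = \<epsilon> \<and> scal n2 n2 = - \<epsilon> \<and> scal n1 n2 = 0"

definition lorentzian_surface :: "(real \<times> real) set \<Rightarrow> surface \<Rightarrow> bool" where
  "lorentzian_surface U \<Psi> \<longleftrightarrow> open U \<and> smooth_on U \<Psi> \<and>
     (\<forall>p\<in>U. inj (dmap \<Psi> p) \<and> (\<exists>x y. tangent_frame \<Psi> p x y))"

text \<open>Half the trace of the second fundamental form with respect to the induced metric.\<close>

definition mean_curvature_vector :: "surface \<Rightarrow> real \<times> real \<Rightarrow> real^4" where
  "mean_curvature_vector \<Psi> p =
     (1 / (2 * (coefE \<Psi> p * coefG \<Psi> p - (coefF \<Psi> p)\<^sup>2))) *\<^sub>R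
     (coefG \<Psi> p *\<^sub>R second_form \<Psi> p (1, 0) (1, 0)
      - (2 * coefF \<Psi> p) *\<^sub>R second_form \<Psi> p (1, 0) (0, 1)
      + coefE \<Psi> p *\<^sub>R second_form \<Psi> p (0, 1) (0, 1))"

definition minimal_lorentzian_surface :: "(real \<times> real) set \<Rightarrow> surface \<Rightarrow> bool" where
  "minimal_lorentzian_surface U \<Psi> \<longleftrightarrow>
     lorentzian_surface U \<Psi> \<and> (\<forall>p\<in>U. mean_curvature_vector \<Psi> p = 0)"

definition first_normal_space :: "surface \<Rightarrow> real \<times> real \<Rightarrow> (real^4) set" where
  "first_normal_space \<Psi> p = span {second_form \<Psi> p \<xi> \<eta> | \<xi> \<eta>. True}"

text \<open>\<open>K\<close> is the Gauss curvature and \<open>\<kappa>\<close> the normal curvature at a point of a minimal Lorentzian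
  surface, in terms of the second fundamental form (Gauss and Ricci equations).  \<open>K\<close> is
  independent of the frames; \<open>\<kappa>\<close> is defined up to the sign given by their orientations.\<close>

definition curvatures :: "surface \<Rightarrow> real \<times> real \<Rightarrow> real \<Rightarrow> real \<Rightarrow> bool" where
  "curvatures \<Psi> p K \<kappa> \<longleftrightarrow> (\<exists>x y e1 e2 a b c d.
     tangent_frame \<Psi> p x y \<and> normal_frame \<Psi> p 1 e1 e2 \<and>
     second_form \<Psi> p x x = a *\<^sub>R e1 + b *\<^sub>R e2 \<and>
     second_form \<Psi> p y y = a *\<^sub>R e1 + b *\<^sub>R e2 \<and>
     second_form \<Psi> p x y = c *\<^sub>R e1 + d *\<^sub>R e2 \<and>
     K = b\<^sup>2 - a\<^sup>2 + c\<^sup>2 - d\<^sup>2 \<and> \<kappa> = 2 * (b * c - a * d))"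

definition general_type :: "(real \<times> real) set \<Rightarrow> surface \<Rightarrow> bool" where
  "general_type U \<Psi> \<longleftrightarrow> (\<forall>p\<in>U. dim (first_normal_space \<Psi> p) = 2 \<and>
     (\<exists>K \<kappa>. curvatures \<Psi> p K \<kappa> \<and> K\<^sup>2 - \<kappa>\<^sup>2 > 0))"

section \<open>Canonical parameters\<close>

definition canonical_frame ::
    "surface \<Rightarrow> real \<times> real \<Rightarrow> real \<times> real \<Rightarrow> real \<times> real \<Rightarrow> real \<Rightarrow> real \<Rightarrow> bool" where
  "canonical_frame \<Psi> p x y \<nu> \<mu> \<longleftrightarrow> tangent_frame \<Psi> p x y \<and>
     (\<exists>n1 n2 \<epsilon>. \<epsilon> \<in> {1, -1} \<and> normal_frame \<Psi> p \<epsilon> n1 n2 \<and>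
        second_form \<Psi> p x x = \<nu> *\<^sub>R n1 \<and> second_form \<Psi> p y y = \<nu> *\<^sub>R n1 \<and>
        second_form \<Psi> p x y = \<mu> *\<^sub>R n2) \<and>
     \<nu> * \<mu> \<noteq> 0"

text \<open>The frame is \<open>x = \<Psi>\<^sub>u / f\<close>, \<open>y = \<Psi>\<^sub>v / f\<close>, where \<open>E = f\<^sup>2\<close> and \<open>f > 0\<close>.\<close>

definition canonical_parameters :: "(real \<times> real) set \<Rightarrow> surface \<Rightarrow> bool" where
  "canonical_parameters U \<Psi> \<longleftrightarrow> (\<forall>p\<in>U.
     coefE \<Psi> p = - coefG \<Psi> p \<and> coefF \<Psi> p = 0 \<and> coefE \<Psi> p > 0 \<and>
     (\<exists>\<nu> \<mu>. canonical_frame \<Psi> p (1 / sqrt (coefE \<Psi> p), 0) (0, 1 / sqrt (coefE \<Psi> p)) \<nu> \<mu> \<and>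
        (coefE \<Psi> p)\<^sup>2 = 1 / \<bar>\<mu>\<^sup>2 - \<nu>\<^sup>2\<bar> \<and> (coefG \<Psi> p)\<^sup>2 = 1 / \<bar>\<mu>\<^sup>2 - \<nu>\<^sup>2\<bar>))"

text \<open>Canonical parameters name the parameter with space-like coordinate lines first
  (\<open>E = f\<^sup>2\<close>).  For a representation \<open>\<beta>(u + v) + \<theta>(u - v)\<close> with prescribed \<open>\<beta>\<close> and \<open>\<theta>\<close> the sign
  of \<open>E\<close> is not at one's disposal; if \<open>E < 0\<close>, the parameters are taken in the order
  \<open>(v, u)\<close>.\<close>

definition canonical_up_to_order :: "(real \<times> real) set \<Rightarrow> surface \<Rightarrow> bool" where
  "canonical_up_to_order U \<Psi> \<longleftrightarrow>
     (if \<forall>p\<in>U. coefE \<Psi> p > 0 then canonical_parameters U \<Psi>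
      else canonical_parameters (prod.swap ` U) (\<Psi> \<circ> prod.swap))"

section \<open>Representations by null curves\<close>

definition plus_range :: "(real \<times> real) set \<Rightarrow> real set" where
  "plus_range U = (\<lambda>(u, v). u + v) ` U"

definition minus_range :: "(real \<times> real) set \<Rightarrow> real set" where
  "minus_range U = (\<lambda>(u, v). u - v) ` U"

definition canonical_representation ::
    "(real \<times> real) set \<Rightarrow> surface \<Rightarrow> (real \<Rightarrow> real) \<Rightarrow> (real \<Rightarrow> real) \<Rightarrow> (real \<Rightarrow> real) \<Rightarrow> (real \<Rightarrow> real) \<Rightarrow> bool"
  where
  "canonical_representation V \<Phi> g1 h1 g2 h2 \<longleftrightarrow>
     canonical_up_to_order V \<Phi> \<and>
     smooth_on (plus_range V) g1 \<and> smooth_on (plus_range V) h1 \<and>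
     smooth_on (minus_range V) g2 \<and> smooth_on (minus_range V) h2 \<and>
     (\<exists>\<beta> \<theta>. null_curve (plus_range V) \<beta> \<and> null_curve (minus_range V) \<theta> \<and>
        (\<forall>(u, v)\<in>V. \<Phi> (u, v) = \<beta> (u + v) + \<theta> (u - v)) \<and>
        (\<forall>z\<in>plus_range V. vector_derivative \<beta> (at z) =
           (1 / (4 * sqrt \<bar>deriv g1 z * deriv h1 z\<bar>)) *\<^sub>R null_vec (g1 z) (h1 z)) \<and>
        (\<forall>z\<in>minus_range V. vector_derivative \<theta> (at z) =
           (1 / (4 * sqrt \<bar>deriv g2 z * deriv h2 z\<bar>)) *\<^sub>R null_vec (g2 z) (h2 z)))"

definition parameter_map :: "(real \<Rightarrow> real) \<Rightarrow> (real \<Rightarrow> real) \<Rightarrow> real \<times> real \<Rightarrow> real \<times> real" where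
  "parameter_map p q = (\<lambda>(u, v). (p (u + v) + q (u - v), p (u + v) - q (u - v)))"

definition change_of_parameters ::
    "(real \<times> real) set \<Rightarrow> (real \<times> real) set \<Rightarrow> (real \<times> real \<Rightarrow> real \<times> real) \<Rightarrow> bool" where
  "change_of_parameters V U \<phi> \<longleftrightarrow> open V \<and> open U \<and> bij_betw \<phi> V U \<and>
     smooth_on V \<phi> \<and> smooth_on U (inv_into V \<phi>)"

end

theory Submission
  imports Defs
begin

text \<open>
  Under the change of parameters, \<open>u + v\<close> is replaced by \<open>2 p(u + v)\<close> and \<open>u - v\<close> by
  \<open>2 q(u - v)\<close>, so the surface stays a sum of two null curves, \<open>\<beta>(2 p)\<close> and \<open>\<theta>(2 q)\<close>,
  and everything can be expressed by their velocities
  \<open>A null_vec a1 b1\<close> and \<open>B null_vec a2 b2\<close>.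

  Uniqueness.  The decomposition of a surface into curves of \<open>u + v\<close> and of \<open>u - v\<close> determines
  the velocities of the curves (\<open>curve_sum_derivative_unique\<close>), and a nonzero multiple of
  \<open>null_vec g h\<close> determines the factor, \<open>g\<close> and \<open>h\<close> (\<open>scaleR_null_vec_eq_iff\<close>).  Hence
  a canonical representation forces \<open>gb1 = g1(2 p)\<close>, \<open>hb1 = h1(2 p)\<close> and an equation for
  \<open>2 p' f1(2 p)\<close>, which is the stated equation for \<open>p'\<close> together with its sign
  (\<open>canonical_velocity_iff\<close>); likewise for \<open>q\<close>.

  Conversely, these equations imply that the parameters are canonical.  The four vectors
  \<open>null_vec ai bj\<close> form a null frame along the surface: those with \<open>i = j\<close> are
  tangent, the mixed ones are normal.  In this frame \<open>\<beta>''\<close> and \<open>\<theta>''\<close> have normal parts \<open>X\<close>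
  and \<open>Y\<close> with \<open>\<langle>X, X\<rangle> = - 4 A\<^sup>2 a1' b1'\<close> and \<open>\<langle>Y, Y\<rangle> = - 4 B\<^sup>2 a2' b2'\<close>
  (\<open>null_sum_surface.scal_normal\<close>).  The canonical coefficients make both equal to the same
  number \<open>\<plusminus>1/4\<close>, the signs agreeing because \<open>a1' b1' a2' b2' > 0\<close>.  Therefore
  \<open>\<sigma>(\<Phi>\<^sub>u, \<Phi>\<^sub>u) = X + Y\<close> is orthogonal to \<open>\<sigma>(\<Phi>\<^sub>u, \<Phi>\<^sub>v) = X - Y\<close>, and the
  sum of their squares is \<open>\<plusminus>1\<close>, which is the normalization
  \<open>E\<^sup>2 \<bar>\<mu>\<^sup>2 - \<nu>\<^sup>2\<bar> = 1\<close>
  (\<open>null_sum_surface.canonical_parametersI\<close>).  That the surface is of general type is used to see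
  that \<open>X\<close> and \<open>Y\<close> are linearly independent, so that neither \<open>X + Y\<close> nor \<open>X - Y\<close> is
  isotropic.

  Existence.  The equations for \<open>p\<close> and \<open>q\<close> are autonomous and of first order; they are solved by
  inverting an antiderivative (\<open>smooth_reparametrization\<close>, \<open>canonical_speed_exists\<close>).
\<close>

section \<open>Smooth maps\<close>

lemma times_differentiable_on_cong:
  assumes "open S" "\<And>x. x \<in> S \<Longrightarrow> f x = g x" "times_differentiable_on S f n"
  shows "times_differentiable_on S g n"
  using assms(2,3)
proof (induction n arbitrary: f g)
  case 0
  then show ?case using continuous_on_cong[of S S f g] by auto
next
  case (Suc n)
  have diff: "f differentiable (at x)" if "x \<in> S" for x
    using Suc.prems(2) that by simp
  have fr: "frechet_derivative f (at x) = frechet_derivative g (at x)" if "x \<in> S" for x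
    by (rule frechet_derivative_transform_within_open[OF diff[OF that] assms(1) that Suc.prems(1)])
  have "g differentiable (at x)" if "x \<in> S" for x
    using diff[OF that] has_derivative_transform_within_open[OF _ assms(1) that Suc.prems(1)]
    unfolding differentiable_def by meson
  moreover have "times_differentiable_on S (\<lambda>x. frechet_derivative g (at x) v) n" for v
    by (rule Suc.IH[where f = "\<lambda>x. frechet_derivative f (at x) v"]) (use fr Suc.prems(2) in auto)
  ultimately show ?case by simp
qed

lemma times_differentiable_on_SucI:
  assumes "open S" "\<And>x. x \<in> S \<Longrightarrow> (f has_derivative f' x) (at x)"
    and "\<And>v. times_differentiable_on S (\<lambda>x. f' x v) n"
  shows "times_differentiable_on S f (Suc n)"
proof -
  have "f differentiable (at x)" if "x \<in> S" for x
    using assms(2)[OF that] by (rule differentiableI)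
  moreover have "times_differentiable_on S (\<lambda>x. frechet_derivative f (at x) v) n" for v
    by (rule times_differentiable_on_cong[OF assms(1) _ assms(3)[of v]])
       (use assms(2) frechet_derivative_at in metis)
  ultimately show ?thesis by simp
qed

lemma times_differentiable_on_Suc_imp:
  "times_differentiable_on S f (Suc n) \<Longrightarrow> times_differentiable_on S f n"
proof (induction n arbitrary: f)
  case 0
  then show ?case
    by (auto intro!: continuous_at_imp_continuous_on differentiable_imp_continuous_within)
next
  case (Suc n)
  show ?case
    unfolding times_differentiable_on.simps
  proof (intro conjI allI)
    show "\<forall>x\<in>S. f differentiable at x" using Suc.prems by simp
    show "times_differentiable_on S (\<lambda>x. frechet_derivative f (at x) v) n" for v
      by (rule Suc.IH) (use Suc.prems in \<open>simp only: times_differentiable_on.simps(2)[of S f]\<close>)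
  qed
qed

lemma times_differentiable_on_has_derivative:
  assumes "times_differentiable_on S f (Suc n)" "x \<in> S"
  shows "(f has_derivative frechet_derivative f (at x)) (at x)"
  using assms frechet_derivative_works by auto

lemma times_differentiable_on_add:
  assumes "open S" "times_differentiable_on S f n" "times_differentiable_on S g n"
  shows "times_differentiable_on S (\<lambda>x. f x + g x) n"
  using assms(2,3)
proof (induction n arbitrary: f g)
  case 0
  then show ?case by (simp add: continuous_on_add)
next
  case (Suc n)
  show ?case
    by (rule times_differentiable_on_SucI[OF assms(1) has_derivative_add])
       (use Suc in \<open>auto intro: times_differentiable_on_has_derivative\<close>)
qed

text \<open>The product rule expresses the derivative by the same operation \<open>b\<close>, so the induction runs
  over the factors only; the factor that is not differentiated is used with one degree of
  smoothness less.\<close>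

lemma times_differentiable_on_bilinear:
  assumes "bounded_bilinear b" "open S"
    and "times_differentiable_on S f n" "times_differentiable_on S g n"
  shows "times_differentiable_on S (\<lambda>x. b (f x) (g x)) n"
  using assms(3,4)
proof (induction n arbitrary: f g)
  case 0
  then show ?case using bounded_bilinear.continuous_on[OF assms(1)] by simp
next
  case (Suc n)
  show ?case
  proof (rule times_differentiable_on_SucI[OF assms(2)])
    show "((\<lambda>x. b (f x) (g x)) has_derivative
       (\<lambda>v. b (f x) (frechet_derivative g (at x) v) + b (frechet_derivative f (at x) v) (g x))) (at x)"
      if "x \<in> S" for x
      by (rule bounded_bilinear.FDERIV[OF assms(1)];
          rule times_differentiable_on_has_derivative[OF _ that]; fact Suc.prems)
    show "times_differentiable_on S (\<lambda>x. b (f x) (frechet_derivative g (at x) v) +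
        b (frechet_derivative f (at x) v) (g x)) n" for v
      using Suc.prems times_differentiable_on_Suc_imp[OF Suc.prems(1)]
        times_differentiable_on_Suc_imp[OF Suc.prems(2)]
      by (intro times_differentiable_on_add[OF assms(2)] Suc.IH) auto
  qed
qed

lemma times_differentiable_on_const:
  "open S \<Longrightarrow> times_differentiable_on S (\<lambda>x. c) n"
proof (induction n arbitrary: c)
  case (Suc n)
  then show ?case
    by (intro times_differentiable_on_SucI[OF _ has_derivative_const]) auto
qed auto

lemma times_differentiable_on_linear:
  assumes "bounded_linear L" "open S"
  shows "times_differentiable_on S L n"
proof (cases n)
  case 0
  then show ?thesis using assms by (simp add: linear_continuous_on)
next
  case (Suc m)
  show ?thesis unfolding Suc
    by (rule times_differentiable_on_SucI[OF assms(2) bounded_linear_imp_has_derivative])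
       (use assms times_differentiable_on_const in auto)
qed

text \<open>Smoothness of a curve can be tested on ordinary derivatives, because
  the Frechet derivative in direction \<open>v\<close> is \<open>v\<close> times the derivative.\<close>

lemma times_differentiable_on_curve_SucI:
  fixes f :: "real \<Rightarrow> 'b::real_normed_vector"
  assumes "open S" "\<And>x. x \<in> S \<Longrightarrow> (f has_vector_derivative f' x) (at x)"
    and "times_differentiable_on S f' n"
  shows "times_differentiable_on S f (Suc n)"
proof (rule times_differentiable_on_SucI[OF assms(1)])
  show "(f has_derivative (\<lambda>v. v *\<^sub>R f' x)) (at x)" if "x \<in> S" for x
    using assms(2)[OF that] by (simp add: has_vector_derivative_def)
  show "times_differentiable_on S (\<lambda>x. v *\<^sub>R f' x) n" for v
    by (intro times_differentiable_on_bilinear[OF bounded_bilinear_scaleR]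
        times_differentiable_on_const assms)
qed

lemma times_differentiable_on_curve_SucD:
  fixes f :: "real \<Rightarrow> 'b::real_normed_vector"
  assumes "open S" "times_differentiable_on S f (Suc n)"
  shows "times_differentiable_on S (\<lambda>x. vector_derivative f (at x)) n"
    and "x \<in> S \<Longrightarrow> (f has_vector_derivative vector_derivative f (at x)) (at x)"
proof -
  show *: "(f has_vector_derivative vector_derivative f (at x)) (at x)" if "x \<in> S" for x
    using assms(2) that by (simp add: vector_derivative_works)
  have "frechet_derivative f (at x) 1 = vector_derivative f (at x)" if "x \<in> S" for x
    using frechet_derivative_at[OF *[OF that, unfolded has_vector_derivative_def]]
    by (metis scaleR_one)
  then show "times_differentiable_on S (\<lambda>x. vector_derivative f (at x)) n"
    using times_differentiable_on_cong[OF assms(1)] assms(2)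
    by (metis (no_types, lifting) times_differentiable_on.simps(2))
qed

lemma times_differentiable_on_compose:
  fixes g :: "'a::real_normed_vector \<Rightarrow> real"
  assumes "open S" "open I" "\<And>x. x \<in> S \<Longrightarrow> g x \<in> I"
    and "times_differentiable_on I f n" "times_differentiable_on S g n"
  shows "times_differentiable_on S (\<lambda>x. f (g x)) n"
  using assms(4,5)
proof (induction n arbitrary: f)
  case 0
  then show ?case using continuous_on_compose2[of I f S g] assms(3) by auto
next
  case (Suc n)
  show ?case
  proof (rule times_differentiable_on_SucI[OF assms(1)])
    show "((\<lambda>x. f (g x)) has_derivative
       (\<lambda>v. frechet_derivative g (at x) v *\<^sub>R vector_derivative f (at (g x)))) (at x)"
      if "x \<in> S" for x
      using has_derivative_compose[OF
          times_differentiable_on_has_derivative[OF Suc.prems(2) that]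
          times_differentiable_on_curve_SucD(2)[OF assms(2) Suc.prems(1) assms(3)[OF that],
            unfolded has_vector_derivative_def]] .
    show "times_differentiable_on S
        (\<lambda>x. frechet_derivative g (at x) v *\<^sub>R vector_derivative f (at (g x))) n" for v
      using Suc.prems
      by (intro times_differentiable_on_bilinear[OF bounded_bilinear_scaleR assms(1)] Suc.IH
          times_differentiable_on_Suc_imp[OF Suc.prems(2)]
          times_differentiable_on_curve_SucD(1)[OF assms(2)]) auto
  qed
qed

lemma smooth_on_cong:
  "smooth_on S f \<Longrightarrow> open S \<Longrightarrow> (\<And>x. x \<in> S \<Longrightarrow> f x = g x) \<Longrightarrow> smooth_on S g"
  unfolding smooth_on_def using times_differentiable_on_cong by blast

lemma smooth_on_add:
  "smooth_on S f \<Longrightarrow> smooth_on S g \<Longrightarrow> open S \<Longrightarrow> smooth_on S (\<lambda>x. f x + g x)"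
  unfolding smooth_on_def using times_differentiable_on_add by blast

lemma smooth_on_scaleR:
  "smooth_on S f \<Longrightarrow> smooth_on S g \<Longrightarrow> open S \<Longrightarrow> smooth_on S (\<lambda>x. f x *\<^sub>R g x)"
  unfolding smooth_on_def using times_differentiable_on_bilinear[OF bounded_bilinear_scaleR] by blast

lemma smooth_on_mult:
  fixes f g :: "'a::real_normed_vector \<Rightarrow> real"
  shows "smooth_on S f \<Longrightarrow> smooth_on S g \<Longrightarrow> open S \<Longrightarrow> smooth_on S (\<lambda>x. f x * g x)"
  using smooth_on_scaleR[of S f g] by simp

lemma smooth_on_const: "open S \<Longrightarrow> smooth_on S (\<lambda>x. c)"
  unfolding smooth_on_def using times_differentiable_on_const by blast

lemma smooth_on_linear: "bounded_linear L \<Longrightarrow> open S \<Longrightarrow> smooth_on S L"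
  unfolding smooth_on_def using times_differentiable_on_linear by blast

lemma smooth_on_compose:
  fixes g :: "'a::real_normed_vector \<Rightarrow> real"
  shows "smooth_on I f \<Longrightarrow> smooth_on S g \<Longrightarrow> open S \<Longrightarrow> open I \<Longrightarrow> (\<And>x. x \<in> S \<Longrightarrow> g x \<in> I)
    \<Longrightarrow> smooth_on S (\<lambda>x. f (g x))"
  unfolding smooth_on_def using times_differentiable_on_compose by blast

lemma smooth_on_vector_derivative:
  fixes f :: "real \<Rightarrow> 'b::real_normed_vector"
  shows "smooth_on S f \<Longrightarrow> open S \<Longrightarrow> smooth_on S (\<lambda>x. vector_derivative f (at x))"
  unfolding smooth_on_def using times_differentiable_on_curve_SucD(1) by blast

lemma smooth_on_has_vector_derivative:
  fixes f :: "real \<Rightarrow> 'b::real_normed_vector"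
  shows "smooth_on S f \<Longrightarrow> open S \<Longrightarrow> x \<in> S \<Longrightarrow>
    (f has_vector_derivative vector_derivative f (at x)) (at x)"
  unfolding smooth_on_def using times_differentiable_on_curve_SucD(2) by blast

lemma smooth_on_has_real_derivative:
  fixes f :: "real \<Rightarrow> real"
  assumes "smooth_on S f" "open S" "x \<in> S"
  shows "(f has_real_derivative deriv f x) (at x)"
  using smooth_on_has_vector_derivative[OF assms]
  by (metis DERIV_deriv_iff_has_field_derivative has_real_derivative_iff_has_vector_derivative)

lemma smooth_on_deriv:
  fixes f :: "real \<Rightarrow> real"
  assumes "smooth_on S f" "open S"
  shows "smooth_on S (deriv f)"
proof (rule smooth_on_cong[OF smooth_on_vector_derivative[OF assms] assms(2)])
  show "vector_derivative f (at x) = deriv f x" if "x \<in> S" for x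
    using smooth_on_has_real_derivative[OF assms that]
    by (simp add: has_real_derivative_iff_has_vector_derivative vector_derivative_at)
qed

lemma smooth_on_imp_continuous_on: "smooth_on S f \<Longrightarrow> continuous_on S f"
  unfolding smooth_on_def using times_differentiable_on.simps(1) by blast

lemma smooth_on_antiderivative:
  fixes f :: "real \<Rightarrow> 'b::real_normed_vector"
  assumes "open S" "\<And>x. x \<in> S \<Longrightarrow> (f has_vector_derivative f' x) (at x)" "smooth_on S f'"
  shows "smooth_on S f"
  unfolding smooth_on_def
  using times_differentiable_on_curve_SucI[OF assms(1,2)] assms(3)[unfolded smooth_on_def]
    times_differentiable_on_Suc_imp by blast

text \<open>A solution of the autonomous equation \<open>y' = F(y)\<close> inherits the smoothness of \<open>F\<close>: if \<open>y\<close> is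
  \<open>n\<close> times differentiable, then so is \<open>F(y) = y'\<close>.  This covers inverse functions as well as
  square roots and reciprocals.\<close>

lemma smooth_on_ode_solution:
  fixes y F :: "real \<Rightarrow> real"
  assumes S: "open S" and I: "open I" and F: "smooth_on I F"
    and y: "\<And>x. x \<in> S \<Longrightarrow> y x \<in> I" "\<And>x. x \<in> S \<Longrightarrow> (y has_real_derivative F (y x)) (at x)"
  shows "smooth_on S y"
  unfolding smooth_on_def
proof
  fix n
  show "times_differentiable_on S y n"
  proof (induction n)
    case 0
    then show ?case by (auto intro!: continuous_at_imp_continuous_on DERIV_isCont y(2))
  next
    case (Suc n)
    show ?case
      by (rule times_differentiable_on_curve_SucI[OF S])
         (use y(2) times_differentiable_on_compose[OF S I y(1) _ Suc] F in
           \<open>auto simp: has_real_derivative_iff_has_vector_derivative smooth_on_def\<close>)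
  qed
qed

lemma smooth_on_inverse: "smooth_on (- {0}) (inverse :: real \<Rightarrow> real)"
proof (rule smooth_on_ode_solution)
  show "smooth_on UNIV (\<lambda>y::real. - y * y)"
    by (intro smooth_on_mult smooth_on_linear bounded_linear_minus bounded_linear_ident open_UNIV)
  show "(inverse has_real_derivative - inverse x * inverse x) (at x)" if "x \<in> - {0}" for x :: real
    using DERIV_inverse[of x UNIV] that by (simp add: power2_eq_square)
qed auto

lemma smooth_on_sqrt: "smooth_on {0<..} sqrt"
proof (rule smooth_on_ode_solution)
  show "smooth_on (- {0}) (\<lambda>y::real. (1 / 2) * inverse y)"
    by (intro smooth_on_mult smooth_on_const smooth_on_inverse) auto
  show "(sqrt has_real_derivative (1 / 2) * inverse (sqrt x)) (at x)" if "x \<in> {0<..}" for x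
    using DERIV_real_sqrt[of x] that by (simp add: field_simps)
qed auto

lemma smooth_on_abs: "smooth_on (- {0}) (abs :: real \<Rightarrow> real)"
proof (rule smooth_on_cong)
  show "smooth_on (- {0}) (\<lambda>x::real. sqrt (x * x))"
    by (intro smooth_on_compose[OF smooth_on_sqrt] smooth_on_mult smooth_on_linear
        bounded_linear_ident)
       (auto simp: zero_less_mult_iff)
qed auto

section \<open>Reparametrization of an interval with prescribed speed\<close>

text \<open>The endpoints are the infimum and the supremum of \<open>T\<close> in the extended reals; openness
  excludes that they belong to \<open>T\<close>.\<close>

lemma open_connected_eq_einterval:
  assumes "open T" "connected T" "T \<noteq> {}"
  obtains a b :: ereal where "a < b" "T = einterval a b"
proof -
  define a where "a = (INF t\<in>T. ereal t)"
  define b where "b = (SUP t\<in>T. ereal t)"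
  have "\<exists>y\<in>T. y < x" "\<exists>y\<in>T. x < y" if x: "x \<in> T" for x
  proof -
    obtain e where e: "e > 0" "\<And>y. dist y x < e \<Longrightarrow> y \<in> T"
      using assms(1) x unfolding open_dist by blast
    show "\<exists>y\<in>T. y < x" "\<exists>y\<in>T. x < y"
      using e(1) e(2)[of "x - e / 2"] e(2)[of "x + e / 2"]
      by (force simp: dist_real_def)+
  qed
  then have 1: "T \<subseteq> einterval a b"
    by (auto simp: einterval_def a_def b_def INF_less_iff less_SUP_iff)
  have 2: "einterval a b \<subseteq> T"
  proof
    fix x assume "x \<in> einterval a b"
    then obtain y z where "y \<in> T" "z \<in> T" "y < x" "x < z"
      by (auto simp: einterval_def a_def b_def INF_less_iff less_SUP_iff)
    then show "x \<in> T" using connectedD_interval[OF assms(2), of y z x] by simp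
  qed
  have "a < b"
    using 1 assms(3) less_trans unfolding einterval_def by blast
  with 1 2 that show thesis by blast
qed

text \<open>\<open>G\<close> is an antiderivative of \<open>k\<close>.  It is injective by Rolle's theorem, hence open, and its
  inverse \<open>P\<close> solves the autonomous equation \<open>P' = 1 / k(P)\<close>.  Thus \<open>P\<close> is smooth on \<open>G ` T\<close>, and
  it runs through all of \<open>T\<close>.\<close>

lemma smooth_reparametrization:
  fixes k :: "real \<Rightarrow> real"
  assumes T: "open T" "connected T" "T \<noteq> {}"
    and k: "smooth_on T k" "\<And>t. t \<in> T \<Longrightarrow> k t \<noteq> 0"
  obtains G P where "open (G ` T)" "smooth_on T G" "smooth_on (G ` T) P"
    "\<And>t. t \<in> T \<Longrightarrow> P (G t) = t"
    "\<And>t. t \<in> T \<Longrightarrow> (P has_real_derivative inverse (k t)) (at (G t))"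
proof -
  obtain a b :: ereal where ab: "a < b" "T = einterval a b"
    using open_connected_eq_einterval[OF T] .
  have "isCont k x" if "x \<in> T" for x
    using smooth_on_imp_continuous_on[OF k(1)] T(1) that continuous_on_eq_continuous_at by blast
  then obtain G where "\<forall>x. a < ereal x \<longrightarrow> ereal x < b \<longrightarrow> (G has_vector_derivative k x) (at x)"
    using einterval_antiderivative[OF ab(1), of k] ab(2) einterval_iff by blast
  then have G': "(G has_real_derivative k x) (at x)" if "x \<in> T" for x
    using that ab(2) by (auto simp: einterval_iff has_real_derivative_iff_has_vector_derivative)
  have contG: "continuous_on T G"
    by (auto intro!: continuous_at_imp_continuous_on DERIV_isCont G')
  have noteq: "G x \<noteq> G y" if "x \<in> T" "y \<in> T" "x < y" for x y
  proof
    assume eq: "G x = G y"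
    have sub: "z \<in> T" if "x \<le> z" "z \<le> y" for z
      using connectedD_interval[OF T(2) \<open>x \<in> T\<close> \<open>y \<in> T\<close> that] .
    have "\<exists>z. x < z \<and> z < y \<and> DERIV G z :> 0"
    proof (rule Rolle[OF \<open>x < y\<close> eq])
      show "continuous_on {x..y} G"
        by (rule continuous_on_subset[OF contG]) (use sub in auto)
      show "G differentiable (at z)" if "x < z" "z < y" for z
        using G'[of z] sub[of z] that real_differentiable_def by force
    qed
    then show False using G' k(2) sub DERIV_unique
      by (metis less_imp_le)
  qed
  have inj: "inj_on G T"
    by (rule inj_onI) (metis noteq linorder_neqE_linordered_idom)
  have interval: "is_interval T" using T(2) by (simp add: is_interval_connected_1)
  have openG: "open (G ` T)"
    using injective_eq_1d_open_map_UNIV[OF contG interval] inj T(1) by blast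
  define P where "P = inv_into T G"
  have PG: "P (G t) = t" if "t \<in> T" for t
    unfolding P_def using inj that by simp
  have P': "(P has_real_derivative inverse (k t)) (at (G t))" if "t \<in> T" for t
    unfolding has_field_derivative_def
    by (rule has_derivative_inverse_strong[OF T(1) that contG PG
          G'[OF that, unfolded has_field_derivative_def]])
       (use k(2)[OF that] in \<open>auto simp: fun_eq_iff\<close>)
  have "smooth_on T (\<lambda>t. inverse (k t))"
    by (rule smooth_on_compose[OF smooth_on_inverse k(1) T(1)]) (use k(2) in auto)
  then have "smooth_on (G ` T) P"
    by (rule smooth_on_ode_solution[OF openG T(1)]) (use PG P' in auto)
  moreover have "smooth_on T G"
    by (rule smooth_on_antiderivative[OF T(1) _ k(1)])
       (use G' in \<open>auto simp: has_real_derivative_iff_has_vector_derivative\<close>)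
  ultimately show thesis using that openG PG P' by blast
qed

section \<open>Isotropic vectors in neutral four-space\<close>

lemma vector_4_nth:
  "(vector [w, x, y, z] :: 'a::zero^4) $ 1 = w" "(vector [w, x, y, z] :: 'a::zero^4) $ 2 = x"
  "(vector [w, x, y, z] :: 'a::zero^4) $ 3 = y" "(vector [w, x, y, z] :: 'a::zero^4) $ 4 = z"
  unfolding vector_def by simp_all

lemma scal_simps:
  "scal (X + Y) Z = scal X Z + scal Y Z" "scal X (Y + Z) = scal X Y + scal X Z"
  "scal (X - Y) Z = scal X Z - scal Y Z" "scal X (Y - Z) = scal X Y - scal X Z"
  "scal (c *\<^sub>R X) Y = c * scal X Y" "scal X (c *\<^sub>R Y) = c * scal X Y"
  by (simp_all add: scal_def algebra_simps)

lemma scal_commute: "scal X Y = scal Y X"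
  by (simp add: scal_def algebra_simps)

lemma scal_null_vec: "scal (null_vec a b) (null_vec c d) = 2 * (a - c) * (b - d)"
  by (simp add: scal_def null_vec_def vector_4_nth algebra_simps)

lemma null_vec_nonzero: "null_vec a b \<noteq> 0"
proof
  assume "null_vec a b = 0"
  then have "null_vec a b $ 1 + null_vec a b $ 3 = 0" by simp
  then show False by (simp add: null_vec_def vector_4_nth)
qed

text \<open>The sum of the first and third entries of \<open>null_vec a b\<close> is \<open>2\<close>, so a nonzero multiple
  of it determines both the factor and the pair \<open>(a, b)\<close>.\<close>

lemma scaleR_null_vec_eq_iff:
  assumes "c \<noteq> 0"
  shows "c *\<^sub>R null_vec a b = d *\<^sub>R null_vec a' b' \<longleftrightarrow> c = d \<and> a = a' \<and> b = b'"
proof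
  assume *: "c *\<^sub>R null_vec a b = d *\<^sub>R null_vec a' b'"
  have i: "c * null_vec a b $ i = d * null_vec a' b' $ i" for i
    using arg_cong[OF *, of "\<lambda>x. x $ i"] by simp
  have "c = d" using i[of 1] i[of 3] by (simp add: null_vec_def vector_4_nth algebra_simps)
  moreover from this have "a - b = a' - b'" "a + b = a' + b'"
    using i[of 2] i[of 4] assms by (simp_all add: null_vec_def vector_4_nth)
  ultimately show "c = d \<and> a = a' \<and> b = b'" by auto
qed auto

text \<open>\<open>null_vec a b\<close> is affine in \<open>a\<close> and in \<open>b\<close>, so its partial derivatives are difference
  quotients with an arbitrary second point: here \<open>c\<close> and \<open>d\<close>.\<close>

lemma null_vec_has_vector_derivative:
  assumes "(a has_real_derivative a') (at t)" "(b has_real_derivative b') (at t)"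
    and "a t \<noteq> c" "b t \<noteq> d"
  shows "((\<lambda>t. null_vec (a t) (b t)) has_vector_derivative
      (a' / (a t - c)) *\<^sub>R (null_vec (a t) (b t) - null_vec c (b t)) +
      (b' / (b t - d)) *\<^sub>R (null_vec (a t) (b t) - null_vec (a t) d)) (at t)"
proof -
  define c0 c1 c2 c3 :: "real^4" where "c0 = vector [1, 0, 1, 0]" and "c1 = vector [0, 1, 0, 1]"
    and "c2 = vector [0, -1, 0, 1]" and "c3 = vector [1, 0, -1, 0]"
  have nv: "null_vec x y = c0 + x *\<^sub>R c1 + y *\<^sub>R c2 + (x * y) *\<^sub>R c3" for x y
    by (simp add: null_vec_def vec_eq_iff forall_4 vector_4_nth c0_def c1_def c2_def c3_def)
  have d: "((\<lambda>t. null_vec (a t) (b t)) has_vector_derivative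
      a' *\<^sub>R c1 + b' *\<^sub>R c2 + (a' * b t + b' * a t) *\<^sub>R c3) (at t)"
    unfolding nv using assms(1,2)
    by (auto intro!: derivative_eq_intros simp: algebra_simps
        simp flip: has_real_derivative_iff_has_vector_derivative)
  have "a' *\<^sub>R c1 + b' *\<^sub>R c2 + (a' * b t + b' * a t) *\<^sub>R c3 =
      (a' / (a t - c)) *\<^sub>R ((a t - c) *\<^sub>R (c1 + b t *\<^sub>R c3)) +
      (b' / (b t - d)) *\<^sub>R ((b t - d) *\<^sub>R (c2 + a t *\<^sub>R c3))"
    using assms(3,4) by (simp add: scaleR_add_right scaleR_add_left mult.commute)
  also have "(a t - c) *\<^sub>R (c1 + b t *\<^sub>R c3) = null_vec (a t) (b t) - null_vec c (b t)"
    by (simp add: nv algebra_simps)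
  also have "(b t - d) *\<^sub>R (c2 + a t *\<^sub>R c3) = null_vec (a t) (b t) - null_vec (a t) d"
    by (simp add: nv algebra_simps)
  finally show ?thesis using d by simp
qed

section \<open>The second fundamental form of a sum of two null curves\<close>

lemma open_plus_range: "open W \<Longrightarrow> open (plus_range W)"
  and open_minus_range: "open W \<Longrightarrow> open (minus_range W)"
proof -
  assume W: "open W"
  have "linear (\<lambda>(u::real, v). u + v)" "surj (\<lambda>(u::real, v). u + v)"
    "linear (\<lambda>(u::real, v). u - v)" "surj (\<lambda>(u::real, v). u - v)"
    by (auto intro!: linearI simp: algebra_simps intro!: surjI[where f = "\<lambda>x. (x, 0)"])
  then show "open (plus_range W)" "open (minus_range W)"
    unfolding plus_range_def minus_range_def using open_surjective_linear_image[OF W] by blast+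
qed

lemma plus_rangeI: "(u, v) \<in> W \<Longrightarrow> u + v \<in> plus_range W"
  and minus_rangeI: "(u, v) \<in> W \<Longrightarrow> u - v \<in> minus_range W"
  by (force simp: plus_range_def minus_range_def)+

lemma plus_rangeE: "z \<in> plus_range W \<Longrightarrow> (\<And>u v. (u, v) \<in> W \<Longrightarrow> z = u + v \<Longrightarrow> R) \<Longrightarrow> R"
  and minus_rangeE: "z \<in> minus_range W \<Longrightarrow> (\<And>u v. (u, v) \<in> W \<Longrightarrow> z = u - v \<Longrightarrow> R) \<Longrightarrow> R"
  by (force simp: plus_range_def minus_range_def)+

locale null_sum_surface =
  fixes W :: "(real \<times> real) set" and \<Phi> :: surface and \<beta> \<theta> :: "real \<Rightarrow> real^4"
    and A a1 b1 B a2 b2 :: "real \<Rightarrow> real"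
  assumes open_domain: "open W"
    and sum: "\<And>u v. (u, v) \<in> W \<Longrightarrow> \<Phi> (u, v) = \<beta> (u + v) + \<theta> (u - v)"
    and deriv_\<beta>: "\<And>t. t \<in> plus_range W \<Longrightarrow>
      (\<beta> has_vector_derivative A t *\<^sub>R null_vec (a1 t) (b1 t)) (at t)"
    and deriv_\<theta>: "\<And>s. s \<in> minus_range W \<Longrightarrow>
      (\<theta> has_vector_derivative B s *\<^sub>R null_vec (a2 s) (b2 s)) (at s)"
    and differentiable_plus: "\<And>t. t \<in> plus_range W \<Longrightarrow>
      A field_differentiable (at t) \<and> a1 field_differentiable (at t) \<and> b1 field_differentiable (at t)"
    and differentiable_minus: "\<And>s. s \<in> minus_range W \<Longrightarrow>
      B field_differentiable (at s) \<and> a2 field_differentiable (at s) \<and> b2 field_differentiable (at s)"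
    and nondegenerate: "\<And>u v. (u, v) \<in> W \<Longrightarrow>
      A (u + v) * B (u - v) * (a1 (u + v) - a2 (u - v)) * (b1 (u + v) - b2 (u - v)) \<noteq> 0"
begin

lemma dmap_eq:
  assumes "(u, v) \<in> W"
  shows "dmap \<Phi> (u, v) \<xi> =
    ((fst \<xi> + snd \<xi>) * A (u + v)) *\<^sub>R null_vec (a1 (u + v)) (b1 (u + v)) +
    ((fst \<xi> - snd \<xi>) * B (u - v)) *\<^sub>R null_vec (a2 (u - v)) (b2 (u - v))"
proof -
  have 1: "((\<lambda>x. \<beta> (fst x + snd x)) has_derivative
      (\<lambda>\<xi>. (fst \<xi> + snd \<xi>) *\<^sub>R A (u + v) *\<^sub>R null_vec (a1 (u + v)) (b1 (u + v)))) (at (u, v))"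
    by (rule has_derivative_compose[where f = "\<lambda>x. fst x + snd x" and g = \<beta>])
       (use deriv_\<beta>[OF plus_rangeI[OF assms]] in
         \<open>auto intro!: derivative_eq_intros simp: has_vector_derivative_def\<close>)
  have 2: "((\<lambda>x. \<theta> (fst x - snd x)) has_derivative
      (\<lambda>\<xi>. (fst \<xi> - snd \<xi>) *\<^sub>R B (u - v) *\<^sub>R null_vec (a2 (u - v)) (b2 (u - v)))) (at (u, v))"
    by (rule has_derivative_compose[where f = "\<lambda>x. fst x - snd x" and g = \<theta>])
       (use deriv_\<theta>[OF minus_rangeI[OF assms]] in
         \<open>auto intro!: derivative_eq_intros simp: has_vector_derivative_def\<close>)
  have "(\<Phi> has_derivative
      (\<lambda>\<xi>. (fst \<xi> + snd \<xi>) *\<^sub>R A (u + v) *\<^sub>R null_vec (a1 (u + v)) (b1 (u + v)) +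
        (fst \<xi> - snd \<xi>) *\<^sub>R B (u - v) *\<^sub>R null_vec (a2 (u - v)) (b2 (u - v)))) (at (u, v))"
    by (rule has_derivative_transform_within_open[OF has_derivative_add[OF 1 2] open_domain assms])
       (auto simp: sum)
  from frechet_derivative_at[OF this, symmetric] show ?thesis
    by (simp add: dmap_def)
qed

text \<open>The null vectors \<open>null_vec a1 b1\<close> and \<open>null_vec a2 b2\<close>, the directions of \<open>\<beta>'\<close> and
  \<open>\<theta>'\<close>, span the tangent plane because \<open>A\<close> and \<open>B\<close> do not vanish.\<close>

lemma range_dmap:
  assumes "(u, v) \<in> W"
  shows "x *\<^sub>R null_vec (a1 (u + v)) (b1 (u + v)) + y *\<^sub>R null_vec (a2 (u - v)) (b2 (u - v))
    \<in> range (dmap \<Phi> (u, v))"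
proof -
  have "A (u + v) \<noteq> 0" "B (u - v) \<noteq> 0" using nondegenerate[OF assms] by auto
  then show ?thesis
    by (intro image_eqI[where x = "((x / A (u + v) + y / B (u - v)) / 2,
        (x / A (u + v) - y / B (u - v)) / 2)"]) (auto simp: dmap_eq[OF assms] field_simps)
qed

text \<open>Uniqueness of the normal part means that only \<open>0\<close> is both tangent and normal.  This holds
  since the two null directions of the tangent plane have a nonzero scalar product: each
  coefficient of a tangent vector is read off by pairing with the other direction.\<close>

lemma normal_part_eqI:
  assumes p: "(u, v) \<in> W" and n: "n \<in> normal_space \<Phi> (u, v)" "w - n \<in> range (dmap \<Phi> (u, v))"
  shows "normal_part \<Phi> (u, v) w = n"
  unfolding normal_part_def
proof (rule the_equality)
  fix n' assume n': "n' \<in> normal_space \<Phi> (u, v) \<and> w - n' \<in> range (dmap \<Phi> (u, v))"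
  let ?X = "null_vec (a1 (u + v)) (b1 (u + v))" and ?Y = "null_vec (a2 (u - v)) (b2 (u - v))"
  obtain \<xi> \<eta> where "w - n = dmap \<Phi> (u, v) \<xi>" "w - n' = dmap \<Phi> (u, v) \<eta>" using n n' by auto
  then have "n' - n = dmap \<Phi> (u, v) \<xi> - dmap \<Phi> (u, v) \<eta>" by (simp add: algebra_simps)
  then obtain x y where xy: "n' - n = x *\<^sub>R ?X + y *\<^sub>R ?Y"
    unfolding dmap_eq[OF p]
    by (metis (no_types, lifting) add_diff_add scaleR_left_diff_distrib)
  have "scal (n' - n) (dmap \<Phi> (u, v) \<xi>) = 0" for \<xi>
    using n(1) n' by (cases \<xi>) (simp add: normal_space_def scal_simps)
  then have "scal (n' - n) ?X = 0" "scal (n' - n) ?Y = 0"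
    using range_dmap[OF p, of 1 0] range_dmap[OF p, of 0 1] by auto
  then have "y = 0" "x = 0"
    using nondegenerate[OF p] unfolding xy by (auto simp: scal_simps scal_null_vec)
  then show "n' = n" using xy by simp
qed (use n in auto)

text \<open>The mixed vectors \<open>null_vec a1 b2\<close> and \<open>null_vec a2 b1\<close> are orthogonal to both tangent
  directions \<open>null_vec a1 b1\<close> and \<open>null_vec a2 b2\<close>; they form a null basis of the normal plane.
  The following two vectors are the normal parts of \<open>\<beta>''\<close> and \<open>\<theta>''\<close> in this basis.\<close>

definition normal_\<beta> :: "real \<times> real \<Rightarrow> real^4" where
  "normal_\<beta> = (\<lambda>(u, v).
     (- A (u + v) * (deriv b1 (u + v) / (b1 (u + v) - b2 (u - v)))) *\<^sub>R null_vec (a1 (u + v)) (b2 (u - v)) +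
     (- A (u + v) * (deriv a1 (u + v) / (a1 (u + v) - a2 (u - v)))) *\<^sub>R null_vec (a2 (u - v)) (b1 (u + v)))"

definition normal_\<theta> :: "real \<times> real \<Rightarrow> real^4" where
  "normal_\<theta> = (\<lambda>(u, v).
     (B (u - v) * (deriv a2 (u - v) / (a1 (u + v) - a2 (u - v)))) *\<^sub>R null_vec (a1 (u + v)) (b2 (u - v)) +
     (B (u - v) * (deriv b2 (u - v) / (b1 (u + v) - b2 (u - v)))) *\<^sub>R null_vec (a2 (u - v)) (b1 (u + v)))"

lemma normal_space_combination:
  assumes "(u, v) \<in> W"
  shows "x *\<^sub>R null_vec (a1 (u + v)) (b2 (u - v)) + y *\<^sub>R null_vec (a2 (u - v)) (b1 (u + v))
    \<in> normal_space \<Phi> (u, v)"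
  by (simp add: normal_space_def dmap_eq[OF assms] scal_simps scal_null_vec)

lemma normal_space_normal:
  assumes "(u, v) \<in> W"
  shows "x *\<^sub>R normal_\<beta> (u, v) + y *\<^sub>R normal_\<theta> (u, v) \<in> normal_space \<Phi> (u, v)"
proof -
  have "normal_\<beta> (u, v) \<in> normal_space \<Phi> (u, v)" "normal_\<theta> (u, v) \<in> normal_space \<Phi> (u, v)"
    unfolding normal_\<beta>_def normal_\<theta>_def prod.case by (rule normal_space_combination[OF assms])+
  then show ?thesis by (simp add: normal_space_def scal_simps)
qed

text \<open>Differentiating \<open>null_vec (a1 t) (b1 t)\<close> by difference quotients against the values of
  \<open>a2\<close> and \<open>b2\<close> produces exactly the two mixed vectors, plus multiples of
  \<open>null_vec a1 b1\<close>, which are tangent.\<close>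

lemma second_derivative_\<beta>:
  assumes "(u, v) \<in> W"
  shows "\<exists>x. ((\<lambda>t. A t *\<^sub>R null_vec (a1 t) (b1 t)) has_vector_derivative
    normal_\<beta> (u, v) + x *\<^sub>R null_vec (a1 (u + v)) (b1 (u + v))) (at (u + v))"
proof -
  let ?t = "u + v" and ?s = "u - v"
  have ne: "a1 ?t \<noteq> a2 ?s" "b1 ?t \<noteq> b2 ?s" using nondegenerate[OF assms] by auto
  have d: "(A has_real_derivative deriv A ?t) (at ?t)" "(a1 has_real_derivative deriv a1 ?t) (at ?t)"
    "(b1 has_real_derivative deriv b1 ?t) (at ?t)"
    using differentiable_plus[OF plus_rangeI[OF assms]]
    by (simp_all add: DERIV_deriv_iff_field_differentiable)
  from has_vector_derivative_scaleR[OF d(1) null_vec_has_vector_derivative[OF d(2,3) ne]]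
  show ?thesis
    by (intro exI[of _ "deriv A ?t + A ?t * (deriv a1 ?t / (a1 ?t - a2 ?s)) +
        A ?t * (deriv b1 ?t / (b1 ?t - b2 ?s))"]; elim back_subst[of "\<lambda>d. (_ has_vector_derivative d) _"])
       (simp add: normal_\<beta>_def algebra_simps)
qed

lemma second_derivative_\<theta>:
  assumes "(u, v) \<in> W"
  shows "\<exists>x. ((\<lambda>t. B t *\<^sub>R null_vec (a2 t) (b2 t)) has_vector_derivative
    normal_\<theta> (u, v) + x *\<^sub>R null_vec (a2 (u - v)) (b2 (u - v))) (at (u - v))"
proof -
  let ?t = "u + v" and ?s = "u - v"
  have ne: "a2 ?s \<noteq> a1 ?t" "b2 ?s \<noteq> b1 ?t" using nondegenerate[OF assms] by auto
  have d: "(B has_real_derivative deriv B ?s) (at ?s)" "(a2 has_real_derivative deriv a2 ?s) (at ?s)"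
    "(b2 has_real_derivative deriv b2 ?s) (at ?s)"
    using differentiable_minus[OF minus_rangeI[OF assms]]
    by (simp_all add: DERIV_deriv_iff_field_differentiable)
  have flip: "x / (a1 ?t - a2 ?s) = - (x / (a2 ?s - a1 ?t))"
    "x / (b1 ?t - b2 ?s) = - (x / (b2 ?s - b1 ?t))" for x
    by (metis minus_diff_eq minus_divide_right)+
  from has_vector_derivative_scaleR[OF d(1) null_vec_has_vector_derivative[OF d(2,3) ne]]
  show ?thesis
    by (intro exI[of _ "deriv B ?s + B ?s * (deriv a2 ?s / (a2 ?s - a1 ?t)) +
        B ?s * (deriv b2 ?s / (b2 ?s - b1 ?t))"]; elim back_subst[of "\<lambda>d. (_ has_vector_derivative d) _"])
       (simp add: normal_\<theta>_def algebra_simps flip)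
qed

text \<open>In the null coordinates \<open>u + v\<close> and \<open>u - v\<close> the Hessian of a sum of curves is diagonal, so
  \<open>\<sigma>(\<Phi>\<^sub>u, \<Phi>\<^sub>u)\<close> and \<open>\<sigma>(\<Phi>\<^sub>u, \<Phi>\<^sub>v)\<close> become the sum and the difference of the
  normal parts of \<open>\<beta>''\<close> and \<open>\<theta>''\<close>.\<close>

lemma second_form_eq:
  assumes "(u, v) \<in> W"
  shows "second_form \<Phi> (u, v) \<xi> \<eta> =
    ((fst \<xi> + snd \<xi>) * (fst \<eta> + snd \<eta>)) *\<^sub>R normal_\<beta> (u, v) +
    ((fst \<xi> - snd \<xi>) * (fst \<eta> - snd \<eta>)) *\<^sub>R normal_\<theta> (u, v)"
proof -
  let ?X = "null_vec (a1 (u + v)) (b1 (u + v))" and ?Y = "null_vec (a2 (u - v)) (b2 (u - v))"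
  obtain x where x: "((\<lambda>t. A t *\<^sub>R null_vec (a1 t) (b1 t)) has_vector_derivative
      normal_\<beta> (u, v) + x *\<^sub>R ?X) (at (u + v))"
    using second_derivative_\<beta>[OF assms] by blast
  obtain y where y: "((\<lambda>t. B t *\<^sub>R null_vec (a2 t) (b2 t)) has_vector_derivative
      normal_\<theta> (u, v) + y *\<^sub>R ?Y) (at (u - v))"
    using second_derivative_\<theta>[OF assms] by blast
  have 1: "((\<lambda>x. A (fst x + snd x) *\<^sub>R null_vec (a1 (fst x + snd x)) (b1 (fst x + snd x)))
      has_derivative (\<lambda>\<eta>. (fst \<eta> + snd \<eta>) *\<^sub>R (normal_\<beta> (u, v) + x *\<^sub>R ?X))) (at (u, v))"
    by (rule has_derivative_compose[where f = "\<lambda>x. fst x + snd x"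
          and g = "\<lambda>t. A t *\<^sub>R null_vec (a1 t) (b1 t)"])
       (use x in \<open>auto intro!: derivative_eq_intros simp: has_vector_derivative_def\<close>)
  have 2: "((\<lambda>x. B (fst x - snd x) *\<^sub>R null_vec (a2 (fst x - snd x)) (b2 (fst x - snd x)))
      has_derivative (\<lambda>\<eta>. (fst \<eta> - snd \<eta>) *\<^sub>R (normal_\<theta> (u, v) + y *\<^sub>R ?Y))) (at (u, v))"
    by (rule has_derivative_compose[where f = "\<lambda>x. fst x - snd x"
          and g = "\<lambda>t. B t *\<^sub>R null_vec (a2 t) (b2 t)"])
       (use y in \<open>auto intro!: derivative_eq_intros simp: has_vector_derivative_def\<close>)
  have "((\<lambda>q. dmap \<Phi> q \<xi>) has_derivative
      (\<lambda>\<eta>. (fst \<xi> + snd \<xi>) *\<^sub>R (fst \<eta> + snd \<eta>) *\<^sub>R (normal_\<beta> (u, v) + x *\<^sub>R ?X) +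
        (fst \<xi> - snd \<xi>) *\<^sub>R (fst \<eta> - snd \<eta>) *\<^sub>R (normal_\<theta> (u, v) + y *\<^sub>R ?Y))) (at (u, v))"
    by (rule has_derivative_transform_within_open[OF has_derivative_add[OF
          has_derivative_scaleR_right[OF 1] has_derivative_scaleR_right[OF 2]] open_domain assms])
       (auto simp: dmap_eq)
  from frechet_derivative_at[OF this, symmetric]
  have *: "frechet_derivative (\<lambda>q. dmap \<Phi> q \<xi>) (at (u, v)) \<eta> =
      (fst \<xi> + snd \<xi>) *\<^sub>R (fst \<eta> + snd \<eta>) *\<^sub>R (normal_\<beta> (u, v) + x *\<^sub>R ?X) +
      (fst \<xi> - snd \<xi>) *\<^sub>R (fst \<eta> - snd \<eta>) *\<^sub>R (normal_\<theta> (u, v) + y *\<^sub>R ?Y)"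
    by simp
  show ?thesis
    unfolding second_form_def *
  proof (rule normal_part_eqI[OF assms normal_space_normal[OF assms]])
    show "(fst \<xi> + snd \<xi>) *\<^sub>R (fst \<eta> + snd \<eta>) *\<^sub>R (normal_\<beta> (u, v) + x *\<^sub>R ?X) +
      (fst \<xi> - snd \<xi>) *\<^sub>R (fst \<eta> - snd \<eta>) *\<^sub>R (normal_\<theta> (u, v) + y *\<^sub>R ?Y) -
      (((fst \<xi> + snd \<xi>) * (fst \<eta> + snd \<eta>)) *\<^sub>R normal_\<beta> (u, v) +
       ((fst \<xi> - snd \<xi>) * (fst \<eta> - snd \<eta>)) *\<^sub>R normal_\<theta> (u, v)) \<in> range (dmap \<Phi> (u, v))"
      using range_dmap[OF assms, of "(fst \<xi> + snd \<xi>) * (fst \<eta> + snd \<eta>) * x"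
          "(fst \<xi> - snd \<xi>) * (fst \<eta> - snd \<eta>) * y"]
      by (elim back_subst[of "\<lambda>w. w \<in> _"]) (simp add: algebra_simps)
  qed
qed

lemma coef_eq:
  assumes "(u, v) \<in> W"
  defines "E \<equiv> 4 * (A (u + v) * B (u - v) * (a1 (u + v) - a2 (u - v)) * (b1 (u + v) - b2 (u - v)))"
  shows "coefE \<Phi> (u, v) = E" "coefF \<Phi> (u, v) = 0" "coefG \<Phi> (u, v) = - E"
  by (simp_all add: coefE_def coefF_def coefG_def first_form_def dmap_eq[OF assms(1)] scal_simps
      scal_null_vec E_def algebra_simps)

text \<open>In the squares the factor \<open>(a1 - a2) (b1 - b2)\<close> of the scalar product of the null basis
  cancels, so each of them is a function of one variable.  This is why the
  normalization \<open>E\<^sup>2 \<bar>\<mu>\<^sup>2 - \<nu>\<^sup>2\<bar> = 1\<close> can be reached by reparametrizing each curve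
  separately.\<close>

lemma scal_normal:
  assumes "(u, v) \<in> W"
  shows "scal (normal_\<beta> (u, v)) (normal_\<beta> (u, v)) =
      - 4 * (A (u + v))\<^sup>2 * (deriv a1 (u + v) * deriv b1 (u + v))"
    and "scal (normal_\<theta> (u, v)) (normal_\<theta> (u, v)) =
      - 4 * (B (u - v))\<^sup>2 * (deriv a2 (u - v) * deriv b2 (u - v))"
    and "scal (normal_\<beta> (u, v)) (normal_\<theta> (u, v)) =
      2 * A (u + v) * B (u - v) * (deriv a1 (u + v) * deriv a2 (u - v) *
        ((b1 (u + v) - b2 (u - v)) / (a1 (u + v) - a2 (u - v))) +
      deriv b1 (u + v) * deriv b2 (u - v) *
        ((a1 (u + v) - a2 (u - v)) / (b1 (u + v) - b2 (u - v))))"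
proof -
  define \<alpha> \<gamma> where "\<alpha> = a1 (u + v) - a2 (u - v)" and "\<gamma> = b1 (u + v) - b2 (u - v)"
  have ne: "\<alpha> \<noteq> 0" "\<gamma> \<noteq> 0" using nondegenerate[OF assms] by (auto simp: \<alpha>_def \<gamma>_def)
  let ?M = "null_vec (a1 (u + v)) (b2 (u - v))" and ?N = "null_vec (a2 (u - v)) (b1 (u + v))"
  have N: "scal ?M ?M = 0" "scal ?N ?N = 0" "scal ?M ?N = - 2 * \<alpha> * \<gamma>" "scal ?N ?M = - 2 * \<alpha> * \<gamma>"
    by (simp_all add: scal_null_vec \<alpha>_def \<gamma>_def algebra_simps)
  show "scal (normal_\<beta> (u, v)) (normal_\<beta> (u, v)) =
      - 4 * (A (u + v))\<^sup>2 * (deriv a1 (u + v) * deriv b1 (u + v))"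
    unfolding normal_\<beta>_def prod.case scal_simps N \<alpha>_def[symmetric] \<gamma>_def[symmetric]
    using ne by (simp add: field_simps power2_eq_square)
  show "scal (normal_\<theta> (u, v)) (normal_\<theta> (u, v)) =
      - 4 * (B (u - v))\<^sup>2 * (deriv a2 (u - v) * deriv b2 (u - v))"
    unfolding normal_\<theta>_def prod.case scal_simps N \<alpha>_def[symmetric] \<gamma>_def[symmetric]
    using ne by (simp add: field_simps power2_eq_square)
  show "scal (normal_\<beta> (u, v)) (normal_\<theta> (u, v)) =
      2 * A (u + v) * B (u - v) * (deriv a1 (u + v) * deriv a2 (u - v) *
        ((b1 (u + v) - b2 (u - v)) / (a1 (u + v) - a2 (u - v))) +
      deriv b1 (u + v) * deriv b2 (u - v) *
        ((a1 (u + v) - a2 (u - v)) / (b1 (u + v) - b2 (u - v))))"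
    unfolding normal_\<beta>_def normal_\<theta>_def prod.case scal_simps N \<alpha>_def[symmetric] \<gamma>_def[symmetric]
    using ne by (simp add: field_simps power2_eq_square)
qed

text \<open>The conclusion says that the coordinate determinant of \<open>normal_\<beta>\<close> and \<open>normal_\<theta>\<close> in the null
  basis does not vanish.  Otherwise the two vectors would be proportional and would span at
  most a line.\<close>

lemma independent_normal_if_dim_2:
  assumes p: "(u, v) \<in> W" and dim: "dim (first_normal_space \<Phi> (u, v)) = 2"
    and nz: "deriv a2 (u - v) \<noteq> 0"
  shows "deriv b1 (u + v) * deriv b2 (u - v) * (a1 (u + v) - a2 (u - v))\<^sup>2 \<noteq>
    deriv a1 (u + v) * deriv a2 (u - v) * (b1 (u + v) - b2 (u - v))\<^sup>2"
proof
  define \<alpha> \<gamma> where "\<alpha> = a1 (u + v) - a2 (u - v)" and "\<gamma> = b1 (u + v) - b2 (u - v)"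
  have ne: "\<alpha> \<noteq> 0" "\<gamma> \<noteq> 0" "B (u - v) \<noteq> 0"
    using nondegenerate[OF p] by (auto simp: \<alpha>_def \<gamma>_def)
  assume eq: "deriv b1 (u + v) * deriv b2 (u - v) * (a1 (u + v) - a2 (u - v))\<^sup>2 =
    deriv a1 (u + v) * deriv a2 (u - v) * (b1 (u + v) - b2 (u - v))\<^sup>2"
  define c where "c = - A (u + v) / B (u - v) * (deriv b1 (u + v) / deriv a2 (u - v)) * (\<alpha> / \<gamma>)"
  have "c * (B (u - v) * (deriv a2 (u - v) / \<alpha>)) = - A (u + v) * (deriv b1 (u + v) / \<gamma>)"
    using ne nz by (simp add: c_def field_simps)
  moreover have "c * (B (u - v) * (deriv b2 (u - v) / \<gamma>)) = - A (u + v) * (deriv a1 (u + v) / \<alpha>)"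
    using ne nz eq unfolding \<alpha>_def[symmetric] \<gamma>_def[symmetric]
    by (simp add: c_def field_simps power2_eq_square)
  ultimately have "normal_\<beta> (u, v) = c *\<^sub>R normal_\<theta> (u, v)"
    unfolding normal_\<beta>_def normal_\<theta>_def prod.case \<alpha>_def[symmetric] \<gamma>_def[symmetric]
    by (simp only: scaleR_add_right scaleR_scaleR)
  then have "{second_form \<Phi> (u, v) \<xi> \<eta> |\<xi> \<eta>. True} \<subseteq> span {normal_\<theta> (u, v)}"
    unfolding second_form_eq[OF p] by (force intro: span_add span_scale span_base)
  then have "first_normal_space \<Phi> (u, v) \<subseteq> span {normal_\<theta> (u, v)}"
    unfolding first_normal_space_def by (intro span_minimal subspace_span)
  then have "dim (first_normal_space \<Phi> (u, v)) \<le> card {normal_\<theta> (u, v)}"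
    by (rule dim_le_card) simp
  then show False using dim by simp
qed

text \<open>Let \<open>X\<close> and \<open>Y\<close> be the normal parts of \<open>\<beta>''\<close> and \<open>\<theta>''\<close>.  The hypotheses on \<open>A\<close> and \<open>B\<close>
  give \<open>\<langle>X, X\<rangle> = \<langle>Y, Y\<rangle> = \<plusminus>1/4\<close>.  Hence \<open>X + Y\<close> and \<open>X - Y\<close>, the values of the second fundamental
  form on \<open>(\<Phi>\<^sub>u, \<Phi>\<^sub>u)\<close> and \<open>(\<Phi>\<^sub>u, \<Phi>\<^sub>v)\<close>, are orthogonal, and the sum of their
  squares is \<open>\<plusminus>1\<close>.  By the determinant condition the Gram determinant of \<open>X, Y\<close>
  is negative, so those squares have opposite signs.  Therefore the coordinate directions are
  canonical, and \<open>E\<^sup>2 (\<mu>\<^sup>2 - \<nu>\<^sup>2) = \<plusminus>1\<close>.\<close>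

lemma canonical_parametersI:
  assumes E: "\<And>p. p \<in> W \<Longrightarrow> coefE \<Phi> p > 0"
    and A: "\<And>t. t \<in> plus_range W \<Longrightarrow> 16 * (A t)\<^sup>2 * \<bar>deriv a1 t * deriv b1 t\<bar> = 1"
    and B: "\<And>s. s \<in> minus_range W \<Longrightarrow> 16 * (B s)\<^sup>2 * \<bar>deriv a2 s * deriv b2 s\<bar> = 1"
    and pos: "\<And>u v. (u, v) \<in> W \<Longrightarrow>
      deriv a1 (u + v) * deriv b1 (u + v) * (deriv a2 (u - v) * deriv b2 (u - v)) > 0"
    and ind: "\<And>u v. (u, v) \<in> W \<Longrightarrow>
      deriv b1 (u + v) * deriv b2 (u - v) * (a1 (u + v) - a2 (u - v))\<^sup>2 \<noteq>
      deriv a1 (u + v) * deriv a2 (u - v) * (b1 (u + v) - b2 (u - v))\<^sup>2"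
  shows "canonical_parameters W \<Phi>"
  unfolding canonical_parameters_def
proof (rule ballI, goal_cases)
  case (1 p)
  obtain u v where p: "p = (u, v)" by fastforce
  have W: "(u, v) \<in> W" using 1 p by simp
  define e where "e = coefE \<Phi> (u, v)"
  have e: "e > 0" using E[OF W] by (simp add: e_def)
  have efg: "coefE \<Phi> (u, v) = e" "coefF \<Phi> (u, v) = 0" "coefG \<Phi> (u, v) = - e"
    using coef_eq[OF W] by (simp_all add: e_def)
  define X Y where "X = normal_\<beta> (u, v)" and "Y = normal_\<theta> (u, v)"
  define m n where "m = scal (X + Y) (X + Y)" and "n = scal (X - Y) (X - Y)"
  have orth: "scal (X + Y) (X - Y) = 0" and mn1: "\<bar>m + n\<bar> = 1" and mn: "m * n < 0"
  proof -
    define \<alpha> \<gamma> where "\<alpha> = a1 (u + v) - a2 (u - v)" and "\<gamma> = b1 (u + v) - b2 (u - v)"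
    have ne: "\<alpha> \<noteq> 0" "\<gamma> \<noteq> 0" "A (u + v) \<noteq> 0" "B (u - v) \<noteq> 0"
      using nondegenerate[OF W] by (auto simp: \<alpha>_def \<gamma>_def)
    define x y where "x = deriv a1 (u + v) * deriv b1 (u + v)"
      and "y = deriv a2 (u - v) * deriv b2 (u - v)"
    have xy: "x * y > 0" using pos[OF W] by (simp add: x_def y_def)
    have Ax: "16 * (A (u + v))\<^sup>2 * \<bar>x\<bar> = 1" and By: "16 * (B (u - v))\<^sup>2 * \<bar>y\<bar> = 1"
      using A[OF plus_rangeI[OF W]] B[OF minus_rangeI[OF W]] by (simp_all add: x_def y_def)
    have XX: "scal X X = - 4 * (A (u + v))\<^sup>2 * x" and YY: "scal Y Y = - 4 * (B (u - v))\<^sup>2 * y"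
      using scal_normal(1,2)[OF W] by (simp_all add: X_def Y_def x_def y_def)
    have eq: "scal X X = scal Y Y"
      using Ax By xy unfolding XX YY by (auto simp: zero_less_mult_iff)
    have abs: "\<bar>4 * scal X X\<bar> = 1"
      using Ax unfolding XX by (auto simp: abs_mult)
    define r s where "r = deriv a1 (u + v) * deriv a2 (u - v) * (\<gamma> / \<alpha>)"
      and "s = deriv b1 (u + v) * deriv b2 (u - v) * (\<alpha> / \<gamma>)"
    \<comment> \<open>The Gram determinant is a discriminant: with \<open>r\<close> and \<open>s\<close> the two terms of \<open>\<langle>X, Y\<rangle>\<close>, it
      compares \<open>4 r s\<close> with \<open>(r + s)\<^sup>2\<close>.\<close>
    have rs: "r * s = x * y" using ne by (simp add: r_def s_def x_def y_def)
    have XY: "scal X Y = 2 * A (u + v) * B (u - v) * (r + s)"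
      using scal_normal(3)[OF W] by (simp add: X_def Y_def r_def s_def \<alpha>_def \<gamma>_def)
    have "r \<noteq> s"
      using ind[OF W] ne unfolding \<alpha>_def[symmetric] \<gamma>_def[symmetric]
      by (auto simp: r_def s_def field_simps power2_eq_square)
    have "scal X X * scal Y Y - (scal X Y)\<^sup>2 =
        16 * (A (u + v))\<^sup>2 * (B (u - v))\<^sup>2 * (x * y) - 4 * (A (u + v))\<^sup>2 * (B (u - v))\<^sup>2 * (r + s)\<^sup>2"
      unfolding XX YY XY by (simp add: power_mult_distrib)
    also have "\<dots> = - ((2 * A (u + v) * B (u - v) * (r - s))\<^sup>2)"
      unfolding rs[symmetric] by (simp add: power2_eq_square algebra_simps)
    also have "\<dots> < 0" using ne \<open>r \<noteq> s\<close> by simp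
    finally have gram: "scal X X * scal Y Y - (scal X Y)\<^sup>2 < 0" .
    show "scal (X + Y) (X - Y) = 0"
      using eq scal_commute[of X Y] by (simp add: scal_simps)
    have m: "m = 2 * scal X X + 2 * scal X Y" and n: "n = 2 * scal X X - 2 * scal X Y"
      using eq scal_commute[of X Y] by (simp_all add: m_def n_def scal_simps)
    show "\<bar>m + n\<bar> = 1" using abs m n by simp
    have "m * n = 4 * (scal X X * scal Y Y - (scal X Y)\<^sup>2)"
      unfolding m n eq[symmetric] by (simp add: power2_eq_square algebra_simps)
    then show "m * n < 0" using gram by simp
  qed
  define \<nu> \<mu> where "\<nu> = sqrt \<bar>m\<bar> / e" and "\<mu> = sqrt \<bar>n\<bar> / e"
  define n1 n2 where "n1 = (1 / sqrt \<bar>m\<bar>) *\<^sub>R (X + Y)" and "n2 = (1 / sqrt \<bar>n\<bar>) *\<^sub>R (X - Y)"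
  have mne: "m \<noteq> 0" "n \<noteq> 0" and sgn: "sgn n = - sgn m" using mn by (auto simp: mult_less_0_iff)
  have sq: "sqrt e * sqrt e = e" using e by simp
  have normal: "normal_frame \<Phi> (u, v) (sgn m) n1 n2"
  proof -
    have "x *\<^sub>R X + y *\<^sub>R Y \<in> normal_space \<Phi> (u, v)" for x y
      using normal_space_normal[OF W] by (simp add: X_def Y_def)
    from this[of "1 / sqrt \<bar>m\<bar>" "1 / sqrt \<bar>m\<bar>"] this[of "1 / sqrt \<bar>n\<bar>" "- (1 / sqrt \<bar>n\<bar>)"]
    have "n1 \<in> normal_space \<Phi> (u, v)" "n2 \<in> normal_space \<Phi> (u, v)"
      by (simp_all add: n1_def n2_def algebra_simps)
    moreover have "scal n1 n1 = sgn m"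
      using mne by (simp add: n1_def scal_simps(5,6) m_def[symmetric] sgn_if flip: abs_if) 
    moreover have "scal n2 n2 = - sgn m"
      using mne sgn by (simp add: n2_def scal_simps(5,6) n_def[symmetric] sgn_if split: if_splits)
    moreover have "scal n1 n2 = 0"
      using orth by (simp add: n1_def n2_def scal_simps(5,6))
    ultimately show ?thesis by (simp add: normal_frame_def)
  qed
  let ?x = "(1 / sqrt e, 0 :: real)" and ?y = "(0 :: real, 1 / sqrt e)"
  have form: "first_form \<Phi> (u, v) ?x ?x = coefE \<Phi> (u, v) / e"
    "first_form \<Phi> (u, v) ?y ?y = coefG \<Phi> (u, v) / e"
    "first_form \<Phi> (u, v) ?x ?y = coefF \<Phi> (u, v) / e"
    using sq e by (simp_all add: first_form_def coefE_def coefF_def coefG_def dmap_eq[OF W]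
        scal_simps scal_null_vec field_simps)
  have "tangent_frame \<Phi> (u, v) ?x ?y"
    using e unfolding tangent_frame_def form efg by simp
  moreover have "second_form \<Phi> (u, v) ?x ?x = \<nu> *\<^sub>R n1" "second_form \<Phi> (u, v) ?y ?y = \<nu> *\<^sub>R n1"
    "second_form \<Phi> (u, v) ?x ?y = \<mu> *\<^sub>R n2"
    using sq mne unfolding second_form_eq[OF W] X_def[symmetric] Y_def[symmetric]
    by (simp_all add: \<nu>_def \<mu>_def n1_def n2_def algebra_simps)
  moreover have "\<nu> * \<mu> \<noteq> 0" "sgn m \<in> {1, -1}" using e mne by (auto simp: \<nu>_def \<mu>_def sgn_if)
  ultimately have frame: "canonical_frame \<Phi> (u, v) ?x ?y \<nu> \<mu>"
    using normal unfolding canonical_frame_def by blast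
  have "\<mu>\<^sup>2 - \<nu>\<^sup>2 = (\<bar>n\<bar> - \<bar>m\<bar>) / e\<^sup>2"
    by (simp add: \<mu>_def \<nu>_def power_divide diff_divide_distrib)
  moreover have "\<bar>\<bar>n\<bar> - \<bar>m\<bar>\<bar> = 1" using mn mn1 by (auto simp: mult_less_0_iff)
  ultimately have "\<bar>\<mu>\<^sup>2 - \<nu>\<^sup>2\<bar> = 1 / e\<^sup>2" by (simp add: abs_divide)
  then have "e\<^sup>2 = 1 / \<bar>\<mu>\<^sup>2 - \<nu>\<^sup>2\<bar>" using e by simp
  then show ?case
    unfolding p efg using e frame by (auto simp: efg)
qed

text \<open>Exchanging the two parameters keeps \<open>u + v\<close> and reverses \<open>u - v\<close>, which amounts to
  traversing \<open>\<theta>\<close> backwards.\<close>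

lemma swap_parameters:
  "null_sum_surface (prod.swap ` W) (\<Phi> \<circ> prod.swap) \<beta> (\<lambda>s. \<theta> (- s)) A a1 b1
     (\<lambda>s. - B (- s)) (\<lambda>s. a2 (- s)) (\<lambda>s. b2 (- s))"
proof
  have plus: "plus_range (prod.swap ` W) = plus_range W"
    by (force simp: plus_range_def image_image add.commute split: prod.splits)
  have minus: "- s \<in> minus_range W" if "s \<in> minus_range (prod.swap ` W)" for s
    using that by (force simp: minus_range_def split: prod.splits)
  show "open (prod.swap ` W)"
    using open_domain by (rule open_surjective_linear_image) (auto intro!: linearI)
  show "(\<Phi> \<circ> prod.swap) (u, v) = \<beta> (u + v) + \<theta> (- (u - v))" if "(u, v) \<in> prod.swap ` W" for u v
    using that sum[of v u] by (auto simp: add.commute)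
  show "(\<beta> has_vector_derivative A t *\<^sub>R null_vec (a1 t) (b1 t)) (at t)"
    "A field_differentiable (at t) \<and> a1 field_differentiable (at t) \<and> b1 field_differentiable (at t)"
    if "t \<in> plus_range (prod.swap ` W)" for t
    using that deriv_\<beta> differentiable_plus by (simp_all add: plus)
  show "((\<lambda>s. \<theta> (- s)) has_vector_derivative - B (- s) *\<^sub>R null_vec (a2 (- s)) (b2 (- s))) (at s)"
    if "s \<in> minus_range (prod.swap ` W)" for s
  proof -
    have "(uminus has_vector_derivative (-1 :: real)) (at s)"
      by (auto intro!: derivative_eq_intros)
    from vector_diff_chain_at[OF this deriv_\<theta>[OF minus[OF that]]] show ?thesis
      by (simp add: o_def)
  qed
  show "(\<lambda>s. - B (- s)) field_differentiable (at s) \<and> (\<lambda>s. a2 (- s)) field_differentiable (at s)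
      \<and> (\<lambda>s. b2 (- s)) field_differentiable (at s)"
    if "s \<in> minus_range (prod.swap ` W)" for s
  proof -
    have "(\<lambda>s. k (- s)) field_differentiable (at s)" if "k field_differentiable (at (- s))"
      for k :: "real \<Rightarrow> real"
      using field_differentiable_compose[of uminus s k] that
      by (simp add: o_def field_differentiable_minus)
    then show ?thesis
      using differentiable_minus[OF minus[OF that]] by (simp add: field_differentiable_minus)
  qed
  show "A (u + v) * - B (- (u - v)) * (a1 (u + v) - a2 (- (u - v))) * (b1 (u + v) - b2 (- (u - v))) \<noteq> 0"
    if "(u, v) \<in> prod.swap ` W" for u v
    using that nondegenerate[of v u] by (auto simp: add.commute)
qed

text \<open>If \<open>E\<close> is negative, exchanging the parameters makes it positive; the other hypotheses
  survive the reversal of \<open>\<theta>\<close>, under which \<open>B\<close>, \<open>a2'\<close> and \<open>b2'\<close> all change sign.\<close>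

lemma canonical_up_to_orderI:
  assumes E: "(\<forall>p\<in>W. coefE \<Phi> p > 0) \<or> (\<forall>p\<in>W. coefE \<Phi> p < 0)"
    and A: "\<And>t. t \<in> plus_range W \<Longrightarrow> 16 * (A t)\<^sup>2 * \<bar>deriv a1 t * deriv b1 t\<bar> = 1"
    and B: "\<And>s. s \<in> minus_range W \<Longrightarrow> 16 * (B s)\<^sup>2 * \<bar>deriv a2 s * deriv b2 s\<bar> = 1"
    and pos: "\<And>u v. (u, v) \<in> W \<Longrightarrow>
      deriv a1 (u + v) * deriv b1 (u + v) * (deriv a2 (u - v) * deriv b2 (u - v)) > 0"
    and ind: "\<And>u v. (u, v) \<in> W \<Longrightarrow>
      deriv b1 (u + v) * deriv b2 (u - v) * (a1 (u + v) - a2 (u - v))\<^sup>2 \<noteq>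
      deriv a1 (u + v) * deriv a2 (u - v) * (b1 (u + v) - b2 (u - v))\<^sup>2"
  shows "canonical_up_to_order W \<Phi>"
proof (cases "\<forall>p\<in>W. coefE \<Phi> p > 0")
  case True
  then have "canonical_parameters W \<Phi>"
    by (intro canonical_parametersI) (use A B pos ind in auto)
  with True show ?thesis by (simp add: canonical_up_to_order_def)
next
  case False
  then have neg: "coefE \<Phi> p < 0" if "p \<in> W" for p using E that by blast
  interpret sw: null_sum_surface "prod.swap ` W" "\<Phi> \<circ> prod.swap" \<beta> "\<lambda>s. \<theta> (- s)" A a1 b1
    "\<lambda>s. - B (- s)" "\<lambda>s. a2 (- s)" "\<lambda>s. b2 (- s)"
    by (rule swap_parameters)
  have d: "deriv (\<lambda>s. a2 (- s)) (v - u) = - deriv a2 (u - v)"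
    "deriv (\<lambda>s. b2 (- s)) (v - u) = - deriv b2 (u - v)" if "(u, v) \<in> W" for u v
  proof -
    have m: "(uminus has_real_derivative -1) (at (v - u))"
      by (auto intro!: derivative_eq_intros)
    have "(a2 has_real_derivative deriv a2 (u - v)) (at (- (v - u)))"
      "(b2 has_real_derivative deriv b2 (u - v)) (at (- (v - u)))"
      using differentiable_minus[OF minus_rangeI[OF that]]
      by (simp_all add: DERIV_deriv_iff_field_differentiable)
    from DERIV_chain2[OF this(1) m] DERIV_chain2[OF this(2) m]
    show "deriv (\<lambda>s. a2 (- s)) (v - u) = - deriv a2 (u - v)"
      "deriv (\<lambda>s. b2 (- s)) (v - u) = - deriv b2 (u - v)"
      by (simp_all add: DERIV_imp_deriv)
  qed
  have "canonical_parameters (prod.swap ` W) (\<Phi> \<circ> prod.swap)"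
  proof (rule sw.canonical_parametersI, goal_cases)
    case (1 p)
    then obtain u v where p: "p = (v, u)" "(u, v) \<in> W" by auto
    show ?case
      using neg[OF p(2)] sw.coef_eq(1)[of v u] coef_eq(1)[OF p(2)] p by (simp add: add.commute)
  next
    case (2 t)
    then show ?case by (elim plus_rangeE) (use A plus_rangeI in \<open>fastforce simp: add.commute\<close>)
  next
    case (3 s)
    then obtain u v where "s = v - u" "(u, v) \<in> W" by (elim minus_rangeE) auto
    then show ?case using B[OF minus_rangeI[of u v]] d by simp
  next
    case (4 v u)
    then show ?case using pos[of u v] d[of u v] by (auto simp: add.commute)
  next
    case (5 v u)
    then show ?case using ind[of u v] d[of u v] by (auto simp: add.commute)
  qed
  then show ?thesis by (simp only: canonical_up_to_order_def False if_False)
qed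

end

section \<open>Change of parameters along the null directions\<close>

text \<open>Two decompositions of the same surface into curves differ by constants locally: fix
  \<open>u - v\<close> and let only \<open>u + v\<close> vary.\<close>

lemma curve_sum_derivative_unique:
  fixes b c b' c' :: "real \<Rightarrow> 'a::real_normed_vector"
  assumes W: "open W" "(u, v) \<in> W"
    and eq: "\<And>u v. (u, v) \<in> W \<Longrightarrow> b (u + v) + c (u - v) = b' (u + v) + c' (u - v)"
    and d: "(b has_vector_derivative d) (at (u + v))" "(b' has_vector_derivative d') (at (u + v))"
  shows "d = d'"
proof -
  let ?s = "u - v"
  define I where "I = (\<lambda>z. ((z + ?s) / 2, (z - ?s) / 2)) -` W"
  have I: "open I" "u + v \<in> I"
    unfolding I_def using W by (auto intro!: open_vimage continuous_intros)
  have "b' z + (c' ?s - c ?s) = b z" if "z \<in> I" for z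
    using eq[of "(z + ?s) / 2" "(z - ?s) / 2"] that
    by (simp add: I_def algebra_simps diff_divide_distrib add_divide_distrib)
  moreover have "((\<lambda>z. b' z + (c' ?s - c ?s)) has_vector_derivative d') (at (u + v))"
    using d(2) by (auto intro!: derivative_eq_intros)
  ultimately have "(b has_vector_derivative d') (at (u + v))"
    using has_vector_derivative_transform_within_open[OF _ I] by blast
  with d(1) show ?thesis by (rule vector_derivative_unique_at)
qed

lemma curve_difference_derivative_unique:
  fixes b c b' c' :: "real \<Rightarrow> 'a::real_normed_vector"
  assumes W: "open W" "(u, v) \<in> W"
    and eq: "\<And>u v. (u, v) \<in> W \<Longrightarrow> b (u + v) + c (u - v) = b' (u + v) + c' (u - v)"
    and d: "(c has_vector_derivative d) (at (u - v))" "(c' has_vector_derivative d') (at (u - v))"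
  shows "d = d'"
proof (rule curve_sum_derivative_unique[where u = u and v = "- v" and b = c and b' = c'])
  show "open ((\<lambda>x. (fst x, - snd x)) -` W)"
    using W by (intro open_vimage continuous_intros)
  show "(u, - v) \<in> (\<lambda>x. (fst x, - snd x)) -` W" using W by simp
  show "c (x + y) + b (x - y) = c' (x + y) + b' (x - y)"
    if "(x, y) \<in> (\<lambda>x. (fst x, - snd x)) -` W" for x y
    using eq[of x "- y"] that by (simp add: add.commute)
qed (use d in auto)

lemma smooth_on_parameter_map:
  assumes "open W" "smooth_on (plus_range W) p" "smooth_on (minus_range W) q"
  shows "smooth_on W (parameter_map p q)"
proof (rule smooth_on_cong)
  have "bounded_linear (\<lambda>x::real \<times> real. fst x + snd x)"
    "bounded_linear (\<lambda>x::real \<times> real. fst x - snd x)"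
    by (auto intro!: bounded_linear_add bounded_linear_sub bounded_linear_fst bounded_linear_snd)
  then show "smooth_on W
      (\<lambda>x. p (fst x + snd x) *\<^sub>R (1, 1) + q (fst x - snd x) *\<^sub>R (1, - 1 :: real))"
    by (intro smooth_on_add[OF smooth_on_scaleR smooth_on_scaleR] smooth_on_const
        smooth_on_compose[OF assms(2) smooth_on_linear] smooth_on_compose[OF assms(3) smooth_on_linear]
        assms(1) open_plus_range open_minus_range)
       (auto intro: plus_rangeI minus_rangeI)
qed (auto simp: assms parameter_map_def)

text \<open>Here \<open>r\<close>, \<open>F\<close> and \<open>J\<close> stand for \<open>p'\<close>, \<open>f(2 p)\<close> and \<open>g' h'\<close> at \<open>2 p\<close>.  Passing to the
  parameter \<open>z\<close> multiplies \<open>g' h'\<close> by \<open>4 p'\<^sup>2\<close>, so the left-hand side compares the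
  canonical coefficient with the coefficient \<open>2 p' f(2 p)\<close> of the velocity.\<close>

lemma speed_equation_iff:
  fixes r F J :: real
  assumes "r \<noteq> 0" "F \<noteq> 0" "J \<noteq> 0"
  shows "1 / (4 * sqrt \<bar>4 * r\<^sup>2 * J\<bar>) = 2 * r * F \<longleftrightarrow>
    r\<^sup>2 = 1 / (16 * \<bar>F\<bar> * sqrt \<bar>J\<bar>) \<and> r * F > 0"
proof -
  have pos: "sqrt \<bar>J\<bar> > 0" using assms by simp
  have s: "sqrt \<bar>4 * r\<^sup>2 * J\<bar> = 2 * \<bar>r\<bar> * sqrt \<bar>J\<bar>"
    by (simp add: abs_mult real_sqrt_mult)
  have "1 / (4 * sqrt \<bar>4 * r\<^sup>2 * J\<bar>) = 2 * r * F \<longleftrightarrow> \<bar>r\<bar> * (r * F) * (16 * sqrt \<bar>J\<bar>) = 1"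
    unfolding s using assms pos by (simp add: field_simps)
  also have "\<dots> \<longleftrightarrow> r\<^sup>2 * \<bar>F\<bar> * (16 * sqrt \<bar>J\<bar>) = 1 \<and> r * F > 0"
  proof (cases "r * F > 0")
    case True
    then have "\<bar>r\<bar> * (r * F) = \<bar>r\<bar> * \<bar>r * F\<bar>" by simp
    also have "\<dots> = r\<^sup>2 * \<bar>F\<bar>" by (simp add: abs_mult power2_eq_square)
    finally show ?thesis using True by simp
  next
    case False
    then have "r * F \<le> 0" by linarith
    then have "\<bar>r\<bar> * (r * F) * (16 * sqrt \<bar>J\<bar>) \<le> 0"
      using pos by (simp add: mult_nonpos_nonneg mult_nonneg_nonpos)
    then show ?thesis using False by linarith
  qed
  also have "\<dots> \<longleftrightarrow> r\<^sup>2 = 1 / (16 * \<bar>F\<bar> * sqrt \<bar>J\<bar>) \<and> r * F > 0"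
    using assms pos by (auto simp: field_simps)
  finally show ?thesis .
qed

lemma deriv_reparametrized:
  fixes p k k' :: "real \<Rightarrow> real"
  assumes I: "open I" and T: "open T" and p: "smooth_on I p" "\<And>z. z \<in> I \<Longrightarrow> 2 * p z \<in> T"
    and k: "\<And>z. z \<in> I \<Longrightarrow> k z = k' (2 * p z)" "smooth_on T k'" and z: "z \<in> I"
  shows "deriv k z = 2 * deriv p z * deriv k' (2 * p z)"
proof -
  have "((\<lambda>z. k' (2 * p z)) has_real_derivative deriv k' (2 * p z) * (2 * deriv p z)) (at z)"
    by (rule DERIV_chain2[where f = k' and g = "\<lambda>z. 2 * p z",
          OF smooth_on_has_real_derivative[OF k(2) T p(2)[OF z]]])
       (use smooth_on_has_real_derivative[OF p(1) I z] in \<open>auto intro!: derivative_eq_intros\<close>)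
  then have "(k has_real_derivative deriv k' (2 * p z) * (2 * deriv p z)) (at z)"
    by (rule has_field_derivative_transform_within_open[OF _ I z]) (simp add: k)
  then show ?thesis by (simp add: DERIV_imp_deriv)
qed

text \<open>The heart of the uniqueness statement, for one of the two curves.  The curve
  \<open>\<beta>(2 p z)\<close> has velocity \<open>2 p' f(2 p) null_vec (g(2 p)) (h(2 p))\<close>; requiring this to be
  the canonical velocity determines first the pair \<open>(gb, hb)\<close> and then \<open>p'\<close>.\<close>

lemma canonical_velocity_iff:
  fixes p f g h gb hb :: "real \<Rightarrow> real"
  assumes I: "open I" and T: "open T" and p: "smooth_on I p" "\<And>z. z \<in> I \<Longrightarrow> 2 * p z \<in> T"
    and gh: "smooth_on T g" "smooth_on T h"
    and f: "\<And>t. t \<in> T \<Longrightarrow> f t \<noteq> 0" and gh': "\<And>t. t \<in> T \<Longrightarrow> deriv g t * deriv h t \<noteq> 0"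
  defines "c \<equiv> \<lambda>z. 1 / (4 * sqrt \<bar>deriv gb z * deriv hb z\<bar>)"
  shows "(\<forall>z\<in>I. c z \<noteq> 0 \<and> c z *\<^sub>R null_vec (gb z) (hb z) =
        (2 * deriv p z * f (2 * p z)) *\<^sub>R null_vec (g (2 * p z)) (h (2 * p z))) \<longleftrightarrow>
    (\<forall>z\<in>I. (deriv p z)\<^sup>2 = 1 / (16 * \<bar>f (2 * p z)\<bar> * sqrt \<bar>deriv g (2 * p z) * deriv h (2 * p z)\<bar>) \<and>
      deriv p z * f (2 * p z) > 0 \<and> gb z = g (2 * p z) \<and> hb z = h (2 * p z))"
    (is "?L \<longleftrightarrow> ?R")
proof -
  have c: "c z = 1 / (4 * sqrt \<bar>4 * (deriv p z)\<^sup>2 * (deriv g (2 * p z) * deriv h (2 * p z))\<bar>)"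
    if "\<And>z. z \<in> I \<Longrightarrow> gb z = g (2 * p z)" "\<And>z. z \<in> I \<Longrightarrow> hb z = h (2 * p z)" "z \<in> I" for z
    using deriv_reparametrized[OF I T p that(1) gh(1) that(3)]
      deriv_reparametrized[OF I T p that(2) gh(2) that(3)]
    by (simp add: c_def power2_eq_square algebra_simps)
  show ?thesis
  proof
    assume ?L
    then have *: "c z \<noteq> 0" "c z = 2 * deriv p z * f (2 * p z)"
      "gb z = g (2 * p z)" "hb z = h (2 * p z)" if "z \<in> I" for z
      using that scaleR_null_vec_eq_iff by blast+
    show ?R
    proof
      fix z assume z: "z \<in> I"
      have "deriv p z \<noteq> 0" using *(1,2)[OF z] by auto
      then show "(deriv p z)\<^sup>2 =
          1 / (16 * \<bar>f (2 * p z)\<bar> * sqrt \<bar>deriv g (2 * p z) * deriv h (2 * p z)\<bar>) \<and>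
        deriv p z * f (2 * p z) > 0 \<and> gb z = g (2 * p z) \<and> hb z = h (2 * p z)"
        using speed_equation_iff[OF _ f gh', of "deriv p z" "2 * p z" "2 * p z"]
          c[OF *(3,4) z] *(2-4)[OF z] p(2)[OF z] by metis
    qed
  next
    assume R: ?R
    show ?L
    proof
      fix z assume z: "z \<in> I"
      have pf: "deriv p z * f (2 * p z) > 0" using R z by blast
      then have "deriv p z \<noteq> 0" by auto
      then have "c z = 2 * deriv p z * f (2 * p z)"
        using speed_equation_iff[OF _ f gh', of "deriv p z" "2 * p z" "2 * p z"]
          c[OF _ _ z] R z p(2)[OF z] by metis
      then show "c z \<noteq> 0 \<and> c z *\<^sub>R null_vec (gb z) (hb z) =
          (2 * deriv p z * f (2 * p z)) *\<^sub>R null_vec (g (2 * p z)) (h (2 * p z))"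
        using pf R z by auto
    qed
  qed
qed

lemma canonical_speed_square:
  assumes "a = 1 / (4 * sqrt \<bar>J\<bar>)" "a > 0"
  shows "16 * a\<^sup>2 * \<bar>J\<bar> = 1"
proof -
  have "J \<noteq> 0" using assms by auto
  then show ?thesis unfolding assms(1) by (simp add: power_divide power_mult_distrib)
qed

text \<open>With \<open>P = 2 p\<close> the required equations become \<open>P' = 1 / k(P)\<close> for
  \<open>k = 2 sgn(f) sqrt(\<bar>f\<bar> sqrt \<bar>g' h'\<bar>)\<close>.\<close>

lemma canonical_speed_exists:
  fixes f g h :: "real \<Rightarrow> real"
  assumes T: "open T" "connected T" "T \<noteq> {}"
    and smooth: "smooth_on T f" "smooth_on T g" "smooth_on T h"
    and nz: "\<And>t. t \<in> T \<Longrightarrow> f t \<noteq> 0" "\<And>t. t \<in> T \<Longrightarrow> deriv g t * deriv h t \<noteq> 0"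
  obtains G p where "open (G ` T)" "smooth_on T G" "smooth_on (G ` T) p"
    "\<And>t. t \<in> T \<Longrightarrow> 2 * p (G t) = t"
    "\<And>z. z \<in> G ` T \<Longrightarrow> (deriv p z)\<^sup>2 =
       1 / (16 * \<bar>f (2 * p z)\<bar> * sqrt \<bar>deriv g (2 * p z) * deriv h (2 * p z)\<bar>)"
    "\<And>z. z \<in> G ` T \<Longrightarrow> deriv p z * f (2 * p z) > 0"
proof -
  define k where "k t = 2 * (f t * inverse \<bar>f t\<bar>) * sqrt (\<bar>f t\<bar> * sqrt \<bar>deriv g t * deriv h t\<bar>)" for t
  have abs_f: "smooth_on T (\<lambda>t. \<bar>f t\<bar>)"
    using T smooth nz by (intro smooth_on_compose[OF smooth_on_abs]) auto
  have abs_gh: "smooth_on T (\<lambda>t. \<bar>deriv g t * deriv h t\<bar>)"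
    using T smooth nz by (intro smooth_on_compose[OF smooth_on_abs] smooth_on_mult smooth_on_deriv) auto
  have "smooth_on T k"
    unfolding k_def
    using T smooth nz abs_f abs_gh
    by (intro smooth_on_mult smooth_on_const smooth_on_compose[OF smooth_on_inverse abs_f]
        smooth_on_compose[OF smooth_on_sqrt smooth_on_mult] smooth_on_compose[OF smooth_on_sqrt abs_gh])
       auto
  moreover have k2: "(k t)\<^sup>2 = 4 * \<bar>f t\<bar> * sqrt \<bar>deriv g t * deriv h t\<bar>"
    and kf: "k t * f t > 0" if "t \<in> T" for t
  proof -
    have "(f t * inverse \<bar>f t\<bar>)\<^sup>2 = 1" using nz(1)[OF that] by (simp add: power_mult_distrib field_simps)
    then show "(k t)\<^sup>2 = 4 * \<bar>f t\<bar> * sqrt \<bar>deriv g t * deriv h t\<bar>"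
      unfolding k_def power_mult_distrib by simp
    have "sqrt (\<bar>f t\<bar> * sqrt \<bar>deriv g t * deriv h t\<bar>) > 0"
      using nz[OF that] by simp
    moreover have "k t * f t =
        2 * ((f t)\<^sup>2 * inverse \<bar>f t\<bar>) * sqrt (\<bar>f t\<bar> * sqrt \<bar>deriv g t * deriv h t\<bar>)"
      by (simp add: k_def power2_eq_square)
    ultimately show "k t * f t > 0" using nz(1)[OF that] by simp
  qed
  moreover have knz: "k t \<noteq> 0" if "t \<in> T" for t using kf[OF that] by auto
  ultimately obtain G P where GP: "open (G ` T)" "smooth_on T G" "smooth_on (G ` T) P"
    "\<And>t. t \<in> T \<Longrightarrow> P (G t) = t"
    "\<And>t. t \<in> T \<Longrightarrow> (P has_real_derivative inverse (k t)) (at (G t))"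
    using smooth_reparametrization[OF T, of k] by metis
  define p where "p z = 1 / 2 * P z" for z
  have p': "deriv p (G t) = inverse (k t) / 2" if "t \<in> T" for t
  proof (rule DERIV_imp_deriv)
    show "(p has_real_derivative inverse (k t) / 2) (at (G t))"
      unfolding p_def using GP(5)[OF that] by (auto intro!: derivative_eq_intros)
  qed
  have p: "2 * p (G t) = t" if "t \<in> T" for t using GP(4)[OF that] by (simp add: p_def)
  show thesis
  proof (rule that[OF GP(1,2) _ p])
    show "smooth_on (G ` T) p"
      unfolding p_def by (intro smooth_on_mult smooth_on_const GP)
    show "(deriv p z)\<^sup>2 = 1 / (16 * \<bar>f (2 * p z)\<bar> * sqrt \<bar>deriv g (2 * p z) * deriv h (2 * p z)\<bar>)"
      if "z \<in> G ` T" for z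
      using that by (auto simp: p p' k2 power_divide power_inverse inverse_eq_divide)
    show "deriv p z * f (2 * p z) > 0" if z: "z \<in> G ` T" for z
    proof -
      obtain t where t: "t \<in> T" "z = G t" using z by blast
      have "inverse (k t) * f t = (k t * f t) / (k t)\<^sup>2"
        using knz[OF t(1)] by (simp add: power2_eq_square field_simps)
      then show ?thesis using kf[OF t(1)] knz[OF t(1)] t by (simp add: p p')
    qed
  qed
qed

section \<open>Existence and uniqueness of the canonical representation\<close>

(* Under u = p + q, v = p - q the arguments of the index-1 and index-2 functions are
   u + v = 2 p and u - v = 2 q; the constant 16 in the equations for p and q is the one
   that belongs to this change of parameters.  Those equations fix p' and q' up to sign,
   and the positive coefficients in the canonical representation fix the signs. *)

theorem theorem4p3:
  fixes U :: "(real \<times> real) set"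
    and \<Psi> :: "real \<times> real \<Rightarrow> real^4"
    and \<beta> \<theta> :: "real \<Rightarrow> real^4"
    and f1 g1 h1 f2 g2 h2 :: "real \<Rightarrow> real"
  assumes domain: "open U" "connected U" "U \<noteq> {}"
    and surface: "minimal_lorentzian_surface U \<Psi>" "general_type U \<Psi>"
    and param: "\<And>u v. (u, v) \<in> U \<Longrightarrow> \<Psi> (u, v) = \<beta> (u + v) + \<theta> (u - v)"
    and null: "null_curve (plus_range U) \<beta>" "null_curve (minus_range U) \<theta>"
    and smooth1: "smooth_on (plus_range U) f1" "smooth_on (plus_range U) g1" "smooth_on (plus_range U) h1"
    and smooth2: "smooth_on (minus_range U) f2" "smooth_on (minus_range U) g2" "smooth_on (minus_range U) h2"
    and beta: "\<And>t. t \<in> plus_range U \<Longrightarrow> vector_derivative \<beta> (at t) = f1 t *\<^sub>R null_vec (g1 t) (h1 t)"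
    and theta: "\<And>s. s \<in> minus_range U \<Longrightarrow> vector_derivative \<theta> (at s) = f2 s *\<^sub>R null_vec (g2 s) (h2 s)"
    and nonzero: "\<And>u v. (u, v) \<in> U \<Longrightarrow>
      f1 (u + v) * f2 (u - v) * (g1 (u + v) - g2 (u - v)) * (h1 (u + v) - h2 (u - v)) \<noteq> 0"
    and positive: "\<And>u v. (u, v) \<in> U \<Longrightarrow>
      deriv g1 (u + v) * deriv g2 (u - v) * deriv h1 (u + v) * deriv h2 (u - v) > 0"
  shows "(\<exists>V p q gb1 hb1 gb2 hb2.
            smooth_on (plus_range V) p \<and> smooth_on (minus_range V) q \<and>
            change_of_parameters V U (parameter_map p q) \<and>
            canonical_representation V (\<Psi> \<circ> parameter_map p q) gb1 hb1 gb2 hb2)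
       \<and> (\<forall>V p q gb1 hb1 gb2 hb2.
            smooth_on (plus_range V) p \<and> smooth_on (minus_range V) q \<and>
            change_of_parameters V U (parameter_map p q) \<longrightarrow>
            (canonical_representation V (\<Psi> \<circ> parameter_map p q) gb1 hb1 gb2 hb2 \<longleftrightarrow>
               (\<forall>z\<in>plus_range V.
                  (deriv p z)\<^sup>2 = 1 / (16 * \<bar>f1 (2 * p z)\<bar> * sqrt \<bar>deriv g1 (2 * p z) * deriv h1 (2 * p z)\<bar>) \<and>
                  deriv p z * f1 (2 * p z) > 0 \<and>
                  gb1 z = g1 (2 * p z) \<and> hb1 z = h1 (2 * p z)) \<and>
               (\<forall>z\<in>minus_range V.
                  (deriv q z)\<^sup>2 = 1 / (16 * \<bar>f2 (2 * q z)\<bar> * sqrt \<bar>deriv g2 (2 * q z) * deriv h2 (2 * q z)\<bar>) \<and>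
                  deriv q z * f2 (2 * q z) > 0 \<and>
                  gb2 z = g2 (2 * q z) \<and> hb2 z = h2 (2 * q z))))"
proof -
  let ?T = "plus_range U" and ?S = "minus_range U"
  have T: "open ?T" "connected ?T" "?T \<noteq> {}" and S: "open ?S" "connected ?S" "?S \<noteq> {}"
    using domain open_plus_range[OF domain(1)] open_minus_range[OF domain(1)]
    by (auto simp: plus_range_def minus_range_def case_prod_unfold
        intro!: connected_continuous_image continuous_intros)
  have nz1: "f1 t \<noteq> 0" "deriv g1 t * deriv h1 t \<noteq> 0" if "t \<in> ?T" for t
    using that nonzero positive by (elim plus_rangeE; force)+
  have nz2: "f2 s \<noteq> 0" "deriv g2 s * deriv h2 s \<noteq> 0" if "s \<in> ?S" for s
    using that nonzero positive by (elim minus_rangeE; force)+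
  have \<beta>': "(\<beta> has_vector_derivative f1 t *\<^sub>R null_vec (g1 t) (h1 t)) (at t)" if "t \<in> ?T" for t
    using smooth_on_has_vector_derivative[OF _ T(1) that, of \<beta>] null(1) beta[OF that]
    by (simp add: null_curve_def)
  have \<theta>': "(\<theta> has_vector_derivative f2 s *\<^sub>R null_vec (g2 s) (h2 s)) (at s)" if "s \<in> ?S" for s
    using smooth_on_has_vector_derivative[OF _ S(1) that, of \<theta>] null(2) theta[OF that]
    by (simp add: null_curve_def)

  \<comment> \<open>General type enters through the independence of the normal parts of \<open>\<beta>''\<close> and \<open>\<theta>''\<close>.\<close>
  interpret S: null_sum_surface U \<Psi> \<beta> \<theta> f1 g1 h1 f2 g2 h2
  proof
    show "f1 field_differentiable (at t) \<and> g1 field_differentiable (at t) \<and> h1 field_differentiable (at t)"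
      if "t \<in> ?T" for t
      using smooth1[THEN smooth_on_has_real_derivative, OF T(1) that]
      by (simp add: DERIV_deriv_iff_field_differentiable)
    show "f2 field_differentiable (at s) \<and> g2 field_differentiable (at s) \<and> h2 field_differentiable (at s)"
      if "s \<in> ?S" for s
      using smooth2[THEN smooth_on_has_real_derivative, OF S(1) that]
      by (simp add: DERIV_deriv_iff_field_differentiable)
  qed (use domain param \<beta>' \<theta>' nonzero in auto)
  have ind: "deriv h1 (u + v) * deriv h2 (u - v) * (g1 (u + v) - g2 (u - v))\<^sup>2 \<noteq>
      deriv g1 (u + v) * deriv g2 (u - v) * (h1 (u + v) - h2 (u - v))\<^sup>2" if "(u, v) \<in> U" for u v
    by (rule S.independent_normal_if_dim_2[OF that])
       (use surface(2) that nz2(2)[OF minus_rangeI[OF that]] in \<open>auto simp: general_type_def\<close>)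

  \<comment> \<open>Up to a positive factor, \<open>\<Delta>\<close> is the coefficient \<open>E\<close> of the reparametrized surface,
    so its sign decides the order of the parameters; it is constant since \<open>U\<close> is connected.\<close>
  define \<Delta> where "\<Delta> = (\<lambda>x. (g1 (fst x + snd x) - g2 (fst x - snd x)) * (h1 (fst x + snd x) - h2 (fst x - snd x)))"
  have "(\<forall>x\<in>U. \<Delta> x > 0) \<or> (\<forall>x\<in>U. \<Delta> x < 0)"
  proof -
    have "continuous_on U (\<lambda>x. k (fst x + snd x))" if "smooth_on ?T k" for k :: "real \<Rightarrow> real"
      by (rule continuous_on_compose2[OF smooth_on_imp_continuous_on[OF that]])
         (auto intro!: continuous_intros plus_rangeI)
    moreover have "continuous_on U (\<lambda>x. k (fst x - snd x))" if "smooth_on ?S k" for k :: "real \<Rightarrow> real"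
      by (rule continuous_on_compose2[OF smooth_on_imp_continuous_on[OF that]])
         (auto intro!: continuous_intros minus_rangeI)
    ultimately have "continuous_on U \<Delta>"
      unfolding \<Delta>_def using smooth1 smooth2 by (intro continuous_intros) auto
    then have "connected (\<Delta> ` U)" using domain(2) connected_continuous_image by blast
    moreover have "0 \<notin> \<Delta> ` U" using nonzero by (force simp: \<Delta>_def)
    ultimately have "\<not> (\<Delta> x \<le> 0 \<and> 0 \<le> \<Delta> y)" if "x \<in> U" "y \<in> U" for x y
      using connectedD_interval[of "\<Delta> ` U" "\<Delta> x" "\<Delta> y" 0] that by blast
    then show ?thesis by (meson not_le)
  qed
  note \<Delta>_sign = this

  let ?eq = "\<lambda>V p f g h gb hb. \<forall>z\<in>V.
    (deriv p z)\<^sup>2 = 1 / (16 * \<bar>f (2 * p z)\<bar> * sqrt \<bar>deriv g (2 * p z) * deriv h (2 * p z)\<bar>) \<and>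
    deriv p z * f (2 * p z) > 0 \<and> gb z = g (2 * p z) \<and> hb z = h (2 * p z)"
  \<comment> \<open>Both conditions say that \<open>\<beta>(2 p)\<close> and \<open>\<theta>(2 q)\<close> have the canonical velocities; these are
    the statements \<open>C1\<close> and \<open>C2\<close> below.\<close>
  have iff: "canonical_representation V (\<Psi> \<circ> parameter_map p q) gb1 hb1 gb2 hb2 \<longleftrightarrow>
      ?eq (plus_range V) p f1 g1 h1 gb1 hb1 \<and> ?eq (minus_range V) q f2 g2 h2 gb2 hb2"
    if p: "smooth_on (plus_range V) p" and q: "smooth_on (minus_range V) q"
      and change: "change_of_parameters V U (parameter_map p q)"
    for V p q gb1 hb1 gb2 hb2
  proof -
    let ?I = "plus_range V" and ?J = "minus_range V"
    have V: "open V" using change by (simp add: change_of_parameters_def)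
    have IJ: "open ?I" "open ?J" using V by (simp_all add: open_plus_range open_minus_range)
    have U: "(p (u + v) + q (u - v), p (u + v) - q (u - v)) \<in> U" if "(u, v) \<in> V" for u v
      using change that unfolding change_of_parameters_def bij_betw_def
      by (force simp: parameter_map_def)
    have pT: "2 * p z \<in> ?T" if "z \<in> ?I" for z
      using that by (rule plus_rangeE) (use plus_rangeI[OF U] in force)
    have qS: "2 * q z \<in> ?S" if "z \<in> ?J" for z
      using that by (rule minus_rangeE) (use minus_rangeI[OF U] in force)
    have \<Phi>: "(\<Psi> \<circ> parameter_map p q) (u, v) = \<beta> (2 * p (u + v)) + \<theta> (2 * q (u - v))"
      if "(u, v) \<in> V" for u v
      using param[OF U[OF that]] by (simp add: parameter_map_def)
    define A B where "A z = 2 * deriv p z * f1 (2 * p z)" and "B z = 2 * deriv q z * f2 (2 * q z)" for z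
    have \<beta>p: "((\<lambda>z. \<beta> (2 * p z)) has_vector_derivative A z *\<^sub>R null_vec (g1 (2 * p z)) (h1 (2 * p z))) (at z)"
      if "z \<in> ?I" for z
    proof -
      have "((\<lambda>z. 2 * p z) has_vector_derivative 2 * deriv p z) (at z)"
        using smooth_on_has_real_derivative[OF p IJ(1) that]
        by (auto intro!: derivative_eq_intros simp flip: has_real_derivative_iff_has_vector_derivative)
      from vector_diff_chain_at[OF this \<beta>'[OF pT[OF that]]] show ?thesis
        by (simp add: o_def A_def)
    qed
    have \<theta>q: "((\<lambda>z. \<theta> (2 * q z)) has_vector_derivative B z *\<^sub>R null_vec (g2 (2 * q z)) (h2 (2 * q z))) (at z)"
      if "z \<in> ?J" for z
    proof -
      have "((\<lambda>z. 2 * q z) has_vector_derivative 2 * deriv q z) (at z)"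
        using smooth_on_has_real_derivative[OF q IJ(2) that]
        by (auto intro!: derivative_eq_intros simp flip: has_real_derivative_iff_has_vector_derivative)
      from vector_diff_chain_at[OF this \<theta>'[OF qS[OF that]]] show ?thesis
        by (simp add: o_def B_def)
    qed
    \<comment> \<open>A coefficient \<open>c1 z = 0\<close> has to be excluded explicitly: it arises, as \<open>1 / 0\<close>, when
      the derivatives of \<open>gb1\<close> or \<open>hb1\<close> vanish.\<close>
    define c1 c2 where "c1 z = 1 / (4 * sqrt \<bar>deriv gb1 z * deriv hb1 z\<bar>)"
      and "c2 z = 1 / (4 * sqrt \<bar>deriv gb2 z * deriv hb2 z\<bar>)" for z
    define C1 C2 where "C1 \<longleftrightarrow> (\<forall>z\<in>?I. c1 z \<noteq> 0 \<and> c1 z *\<^sub>R null_vec (gb1 z) (hb1 z) =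
        A z *\<^sub>R null_vec (g1 (2 * p z)) (h1 (2 * p z)))"
      and "C2 \<longleftrightarrow> (\<forall>z\<in>?J. c2 z \<noteq> 0 \<and> c2 z *\<^sub>R null_vec (gb2 z) (hb2 z) =
        B z *\<^sub>R null_vec (g2 (2 * q z)) (h2 (2 * q z)))"
    have C1_iff: "C1 \<longleftrightarrow> ?eq ?I p f1 g1 h1 gb1 hb1"
      unfolding C1_def c1_def A_def
      using canonical_velocity_iff[OF IJ(1) T(1) p pT smooth1(2,3) nz1] .
    have C2_iff: "C2 \<longleftrightarrow> ?eq ?J q f2 g2 h2 gb2 hb2"
      unfolding C2_def c2_def B_def
      using canonical_velocity_iff[OF IJ(2) S(1) q qS smooth2(2,3) nz2] .
    have "canonical_representation V (\<Psi> \<circ> parameter_map p q) gb1 hb1 gb2 hb2 \<longleftrightarrow> C1 \<and> C2"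
    proof
      assume "canonical_representation V (\<Psi> \<circ> parameter_map p q) gb1 hb1 gb2 hb2"
      then obtain \<beta>b \<theta>b where null': "null_curve ?I \<beta>b" "null_curve ?J \<theta>b"
        and \<Phi>': "\<And>u v. (u, v) \<in> V \<Longrightarrow> (\<Psi> \<circ> parameter_map p q) (u, v) = \<beta>b (u + v) + \<theta>b (u - v)"
        and deriv: "\<And>z. z \<in> ?I \<Longrightarrow> vector_derivative \<beta>b (at z) = c1 z *\<^sub>R null_vec (gb1 z) (hb1 z)"
          "\<And>z. z \<in> ?J \<Longrightarrow> vector_derivative \<theta>b (at z) = c2 z *\<^sub>R null_vec (gb2 z) (hb2 z)"
        unfolding canonical_representation_def c1_def c2_def by blast
      have eq: "\<beta>b (u + v) + \<theta>b (u - v) = \<beta> (2 * p (u + v)) + \<theta> (2 * q (u - v))"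
        if "(u, v) \<in> V" for u v using \<Phi>[OF that] \<Phi>'[OF that] by simp
      have d\<beta>: "(\<beta>b has_vector_derivative c1 z *\<^sub>R null_vec (gb1 z) (hb1 z)) (at z)" if "z \<in> ?I" for z
        using smooth_on_has_vector_derivative[OF _ IJ(1) that, of \<beta>b] null'(1) deriv(1)[OF that]
        by (simp add: null_curve_def)
      have d\<theta>: "(\<theta>b has_vector_derivative c2 z *\<^sub>R null_vec (gb2 z) (hb2 z)) (at z)" if "z \<in> ?J" for z
        using smooth_on_has_vector_derivative[OF _ IJ(2) that, of \<theta>b] null'(2) deriv(2)[OF that]
        by (simp add: null_curve_def)
      have C1
        unfolding C1_def
      proof
        fix z assume z: "z \<in> ?I"
        then obtain u v where uv: "(u, v) \<in> V" "z = u + v" by (rule plus_rangeE)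
        have "c1 z \<noteq> 0" using null'(1) deriv(1)[OF z] z by (force simp: null_curve_def)
        moreover have "c1 z *\<^sub>R null_vec (gb1 z) (hb1 z) = A z *\<^sub>R null_vec (g1 (2 * p z)) (h1 (2 * p z))"
          unfolding uv(2)
          by (rule curve_sum_derivative_unique[where b = \<beta>b and c = \<theta>b and b' = "\<lambda>z. \<beta> (2 * p z)"
                and c' = "\<lambda>z. \<theta> (2 * q z)", OF V uv(1) eq])
             (use d\<beta>[OF z] \<beta>p[OF z] uv(2) in simp_all)
        ultimately show "c1 z \<noteq> 0 \<and> c1 z *\<^sub>R null_vec (gb1 z) (hb1 z) =
            A z *\<^sub>R null_vec (g1 (2 * p z)) (h1 (2 * p z))" by blast
      qed
      moreover have C2
        unfolding C2_def
      proof
        fix z assume z: "z \<in> ?J"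
        then obtain u v where uv: "(u, v) \<in> V" "z = u - v" by (rule minus_rangeE)
        have "c2 z \<noteq> 0" using null'(2) deriv(2)[OF z] z by (force simp: null_curve_def)
        moreover have "c2 z *\<^sub>R null_vec (gb2 z) (hb2 z) = B z *\<^sub>R null_vec (g2 (2 * q z)) (h2 (2 * q z))"
          unfolding uv(2)
          by (rule curve_difference_derivative_unique[where b = \<beta>b and c = \<theta>b and b' = "\<lambda>z. \<beta> (2 * p z)"
                and c' = "\<lambda>z. \<theta> (2 * q z)", OF V uv(1) eq])
             (use d\<theta>[OF z] \<theta>q[OF z] uv(2) in simp_all)
        ultimately show "c2 z \<noteq> 0 \<and> c2 z *\<^sub>R null_vec (gb2 z) (hb2 z) =
            B z *\<^sub>R null_vec (g2 (2 * q z)) (h2 (2 * q z))" by blast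
      qed
      ultimately show "C1 \<and> C2" ..
    next
      assume C: "C1 \<and> C2"
      have R1: "A z > 0" "gb1 z = g1 (2 * p z)" "hb1 z = h1 (2 * p z)" "c1 z = A z" if "z \<in> ?I" for z
        using C C1_iff C1_def that by (auto simp: null_vec_nonzero A_def)
      have R2: "B z > 0" "gb2 z = g2 (2 * q z)" "hb2 z = h2 (2 * q z)" "c2 z = B z" if "z \<in> ?J" for z
        using C C2_iff C2_def that by (auto simp: null_vec_nonzero B_def)
      show "canonical_representation V (\<Psi> \<circ> parameter_map p q) gb1 hb1 gb2 hb2"
        unfolding canonical_representation_def
      proof (intro conjI exI)
        have smooth_p: "smooth_on ?I (\<lambda>z. 2 * p z)" and smooth_q: "smooth_on ?J (\<lambda>z. 2 * q z)"
          using p q IJ by (intro smooth_on_mult smooth_on_const; simp)+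
        note comp_p = smooth_on_compose[OF _ smooth_p IJ(1) T(1) pT]
          and comp_q = smooth_on_compose[OF _ smooth_q IJ(2) S(1) qS]
        show smooth_gb: "smooth_on ?I gb1" "smooth_on ?I hb1" "smooth_on ?J gb2" "smooth_on ?J hb2"
          using smooth_on_cong[OF comp_p[OF smooth1(2)] IJ(1)] smooth_on_cong[OF comp_p[OF smooth1(3)] IJ(1)]
            smooth_on_cong[OF comp_q[OF smooth2(2)] IJ(2)] smooth_on_cong[OF comp_q[OF smooth2(3)] IJ(2)]
            R1 R2 by simp_all
        have smooth_AB: "smooth_on ?I A" "smooth_on ?J B"
          unfolding A_def B_def using p q IJ
          by (intro smooth_on_mult smooth_on_const smooth_on_deriv comp_p[OF smooth1(1)]
              comp_q[OF smooth2(1)]; simp)+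
        have d\<beta>: "((\<lambda>z. \<beta> (2 * p z)) has_vector_derivative A z *\<^sub>R null_vec (gb1 z) (hb1 z)) (at z)"
          if "z \<in> ?I" for z using \<beta>p[OF that] R1[OF that] by simp
        have d\<theta>: "((\<lambda>z. \<theta> (2 * q z)) has_vector_derivative B z *\<^sub>R null_vec (gb2 z) (hb2 z)) (at z)"
          if "z \<in> ?J" for z using \<theta>q[OF that] R2[OF that] by simp
        show "null_curve ?I (\<lambda>z. \<beta> (2 * p z))"
          unfolding null_curve_def
          using comp_p[of \<beta>] null(1) vector_derivative_at[OF d\<beta>] R1(1)[THEN less_imp_neq]
          by (auto simp: null_curve_def scal_simps scal_null_vec null_vec_nonzero)
        show "null_curve ?J (\<lambda>z. \<theta> (2 * q z))"
          unfolding null_curve_def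
          using comp_q[of \<theta>] null(2) vector_derivative_at[OF d\<theta>] R2(1)[THEN less_imp_neq]
          by (auto simp: null_curve_def scal_simps scal_null_vec null_vec_nonzero)
        show "\<forall>(u, v)\<in>V. (\<Psi> \<circ> parameter_map p q) (u, v) = \<beta> (2 * p (u + v)) + \<theta> (2 * q (u - v))"
          using \<Phi> by blast
        show "\<forall>z\<in>?I. vector_derivative (\<lambda>z. \<beta> (2 * p z)) (at z) =
            (1 / (4 * sqrt \<bar>deriv gb1 z * deriv hb1 z\<bar>)) *\<^sub>R null_vec (gb1 z) (hb1 z)"
          using vector_derivative_at[OF d\<beta>] R1(4) by (simp add: c1_def)
        show "\<forall>z\<in>?J. vector_derivative (\<lambda>z. \<theta> (2 * q z)) (at z) =
            (1 / (4 * sqrt \<bar>deriv gb2 z * deriv hb2 z\<bar>)) *\<^sub>R null_vec (gb2 z) (hb2 z)"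
          using vector_derivative_at[OF d\<theta>] R2(4) by (simp add: c2_def)

        \<comment> \<open>It remains to see that the new parameters are canonical.  The hypotheses on the data
          at \<open>2 p\<close> and \<open>2 q\<close> are those on \<open>U\<close>, because these numbers are the sum and the
          difference of the two entries of the parameter map.\<close>
        have dp: "deriv gb1 z = 2 * deriv p z * deriv g1 (2 * p z)"
          "deriv hb1 z = 2 * deriv p z * deriv h1 (2 * p z)" if "z \<in> ?I" for z
          using deriv_reparametrized[OF IJ(1) T(1) p pT _ _ that] R1 smooth1 by blast+
        have dq: "deriv gb2 z = 2 * deriv q z * deriv g2 (2 * q z)"
          "deriv hb2 z = 2 * deriv q z * deriv h2 (2 * q z)" if "z \<in> ?J" for z
          using deriv_reparametrized[OF IJ(2) S(1) q qS _ _ that] R2 smooth2 by blast+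
        have U': "2 * p (u + v) = (p (u + v) + q (u - v)) + (p (u + v) - q (u - v))"
          "2 * q (u - v) = (p (u + v) + q (u - v)) - (p (u + v) - q (u - v))" for u v
          by simp_all
        have on_U: "f1 (2 * p (u + v)) * f2 (2 * q (u - v)) * (g1 (2 * p (u + v)) - g2 (2 * q (u - v))) *
              (h1 (2 * p (u + v)) - h2 (2 * q (u - v))) \<noteq> 0"
          "deriv g1 (2 * p (u + v)) * deriv g2 (2 * q (u - v)) * deriv h1 (2 * p (u + v)) *
              deriv h2 (2 * q (u - v)) > 0"
          "deriv h1 (2 * p (u + v)) * deriv h2 (2 * q (u - v)) * (g1 (2 * p (u + v)) - g2 (2 * q (u - v)))\<^sup>2 \<noteq>
           deriv g1 (2 * p (u + v)) * deriv g2 (2 * q (u - v)) * (h1 (2 * p (u + v)) - h2 (2 * q (u - v)))\<^sup>2"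
          "\<Delta> (p (u + v) + q (u - v), p (u + v) - q (u - v)) =
            (g1 (2 * p (u + v)) - g2 (2 * q (u - v))) * (h1 (2 * p (u + v)) - h2 (2 * q (u - v)))"
          if "(u, v) \<in> V" for u v
          unfolding U' using nonzero[OF U[OF that]] positive[OF U[OF that]] ind[OF U[OF that]]
          by (simp_all only: \<Delta>_def fst_conv snd_conv not_False_eq_True)
        have pz: "deriv p z \<noteq> 0" if "z \<in> ?I" for z using R1(1)[OF that] by (auto simp: A_def)
        have qz: "deriv q z \<noteq> 0" if "z \<in> ?J" for z using R2(1)[OF that] by (auto simp: B_def)

        interpret F: null_sum_surface V "\<Psi> \<circ> parameter_map p q" "\<lambda>z. \<beta> (2 * p z)" "\<lambda>z. \<theta> (2 * q z)"
          A gb1 hb1 B gb2 hb2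
        proof
          show "A field_differentiable (at t) \<and> gb1 field_differentiable (at t) \<and>
              hb1 field_differentiable (at t)" if "t \<in> ?I" for t
            using smooth_AB(1) smooth_gb(1,2) smooth_on_has_real_derivative[OF _ IJ(1) that]
            by (simp add: DERIV_deriv_iff_field_differentiable)
          show "B field_differentiable (at s) \<and> gb2 field_differentiable (at s) \<and>
              hb2 field_differentiable (at s)" if "s \<in> ?J" for s
            using smooth_AB(2) smooth_gb(3,4) smooth_on_has_real_derivative[OF _ IJ(2) that]
            by (simp add: DERIV_deriv_iff_field_differentiable)
          show "A (u + v) * B (u - v) * (gb1 (u + v) - gb2 (u - v)) * (hb1 (u + v) - hb2 (u - v)) \<noteq> 0"
            if "(u, v) \<in> V" for u v
            using on_U(1)[OF that] R1(1-3)[OF plus_rangeI[OF that]] R2(1-3)[OF minus_rangeI[OF that]]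
            by auto
        qed (use V \<Phi> d\<beta> d\<theta> in auto)
        have E: "coefE (\<Psi> \<circ> parameter_map p q) (u, v) = 4 * (A (u + v) * B (u - v)) *
            \<Delta> (p (u + v) + q (u - v), p (u + v) - q (u - v))"
          and AB: "4 * (A (u + v) * B (u - v)) > 0" if "(u, v) \<in> V" for u v
          using F.coef_eq(1)[OF that] on_U(4)[OF that]
            R1(1-3)[OF plus_rangeI[OF that]] R2(1-3)[OF minus_rangeI[OF that]]
          by simp_all
        show "canonical_up_to_order V (\<Psi> \<circ> parameter_map p q)"
        proof (rule F.canonical_up_to_orderI)
          show "(\<forall>x\<in>V. coefE (\<Psi> \<circ> parameter_map p q) x > 0) \<or>
              (\<forall>x\<in>V. coefE (\<Psi> \<circ> parameter_map p q) x < 0)"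
            using \<Delta>_sign
          proof
            assume "\<forall>x\<in>U. \<Delta> x > 0"
            then have "coefE (\<Psi> \<circ> parameter_map p q) (u, v) > 0" if "(u, v) \<in> V" for u v
              unfolding E[OF that] using mult_pos_pos[OF AB[OF that]] U[OF that] by blast
            then show ?thesis by auto
          next
            assume "\<forall>x\<in>U. \<Delta> x < 0"
            then have "coefE (\<Psi> \<circ> parameter_map p q) (u, v) < 0" if "(u, v) \<in> V" for u v
              unfolding E[OF that] using mult_pos_neg[OF AB[OF that]] U[OF that] by blast
            then show ?thesis by auto
          qed
          show "16 * (A t)\<^sup>2 * \<bar>deriv gb1 t * deriv hb1 t\<bar> = 1" if "t \<in> ?I" for t
            using canonical_speed_square R1(1,4)[OF that] unfolding c1_def by metis
          show "16 * (B s)\<^sup>2 * \<bar>deriv gb2 s * deriv hb2 s\<bar> = 1" if "s \<in> ?J" for s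
            using canonical_speed_square R2(1,4)[OF that] unfolding c2_def by metis
          fix u v assume uv: "(u, v) \<in> V"
          define r s where "r = deriv p (u + v)" and "s = deriv q (u - v)"
          have rs: "r \<noteq> 0" "s \<noteq> 0"
            using pz[OF plus_rangeI[OF uv]] qz[OF minus_rangeI[OF uv]] by (simp_all add: r_def s_def)
          note d = dp[OF plus_rangeI[OF uv], folded r_def] dq[OF minus_rangeI[OF uv], folded s_def]
          \<comment> \<open>Each product of derivatives changes by a nonzero factor: the sign condition by
            a square, the determinant condition by the same factor on both sides.\<close>
          have "(4 * r * s)\<^sup>2 * (deriv g1 (2 * p (u + v)) * deriv g2 (2 * q (u - v)) *
              deriv h1 (2 * p (u + v)) * deriv h2 (2 * q (u - v))) > 0"
            using on_U(2)[OF uv] rs by simp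
          then show "deriv gb1 (u + v) * deriv hb1 (u + v) * (deriv gb2 (u - v) * deriv hb2 (u - v)) > 0"
            unfolding d by (simp add: power2_eq_square algebra_simps)
          have "(4 * r * s) * (deriv h1 (2 * p (u + v)) * deriv h2 (2 * q (u - v)) *
              (g1 (2 * p (u + v)) - g2 (2 * q (u - v)))\<^sup>2) \<noteq>
            (4 * r * s) * (deriv g1 (2 * p (u + v)) * deriv g2 (2 * q (u - v)) *
              (h1 (2 * p (u + v)) - h2 (2 * q (u - v)))\<^sup>2)"
            using on_U(3)[OF uv] rs by simp
          then show "deriv hb1 (u + v) * deriv hb2 (u - v) * (gb1 (u + v) - gb2 (u - v))\<^sup>2 \<noteq>
              deriv gb1 (u + v) * deriv gb2 (u - v) * (hb1 (u + v) - hb2 (u - v))\<^sup>2"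
            unfolding d R1(2,3)[OF plus_rangeI[OF uv]] R2(2,3)[OF minus_rangeI[OF uv]]
            by (simp only: ac_simps)
        qed
      qed
    qed
    then show ?thesis unfolding C1_iff C2_iff .
  qed

  \<comment> \<open>Existence: reparametrize both curves over their whole parameter intervals; \<open>V\<close> is the
    domain that corresponds to \<open>U\<close>, which need not be a product of intervals in \<open>u + v\<close> and \<open>u - v\<close>.\<close>
  obtain G p where p: "open (G ` ?T)" "smooth_on ?T G" "smooth_on (G ` ?T) p"
    "\<And>t. t \<in> ?T \<Longrightarrow> 2 * p (G t) = t"
    "\<And>z. z \<in> G ` ?T \<Longrightarrow> (deriv p z)\<^sup>2 =
       1 / (16 * \<bar>f1 (2 * p z)\<bar> * sqrt \<bar>deriv g1 (2 * p z) * deriv h1 (2 * p z)\<bar>)"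
    "\<And>z. z \<in> G ` ?T \<Longrightarrow> deriv p z * f1 (2 * p z) > 0"
    using canonical_speed_exists[OF T smooth1 nz1] by metis
  obtain H q where q: "open (H ` ?S)" "smooth_on ?S H" "smooth_on (H ` ?S) q"
    "\<And>s. s \<in> ?S \<Longrightarrow> 2 * q (H s) = s"
    "\<And>z. z \<in> H ` ?S \<Longrightarrow> (deriv q z)\<^sup>2 =
       1 / (16 * \<bar>f2 (2 * q z)\<bar> * sqrt \<bar>deriv g2 (2 * q z) * deriv h2 (2 * q z)\<bar>)"
    "\<And>z. z \<in> H ` ?S \<Longrightarrow> deriv q z * f2 (2 * q z) > 0"
    using canonical_speed_exists[OF S smooth2 nz2] by metis
  define \<psi> where "\<psi> = parameter_map (\<lambda>t. 1 / 2 * G t) (\<lambda>s. 1 / 2 * H s)"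
  define V where "V = \<psi> ` U"
  have \<psi>: "\<psi> (u, v) = ((G (u + v) + H (u - v)) / 2, (G (u + v) - H (u - v)) / 2)" for u v
    by (simp add: \<psi>_def parameter_map_def add_divide_distrib diff_divide_distrib)
  have sum_diff: "(x + y) / 2 + (x - y) / 2 = x" "(x + y) / 2 - (x - y) / 2 = y" for x y :: real
    by (simp_all add: field_simps)
  have left_inverse: "parameter_map p q (\<psi> x) = x" if x: "x \<in> U" for x
  proof -
    obtain u v where uv: "x = (u, v)" by fastforce
    have "p (G (u + v)) = (u + v) / 2" "q (H (u - v)) = (u - v) / 2"
      using p(4)[of "u + v"] q(4)[of "u - v"] plus_rangeI minus_rangeI x uv by force+
    then show ?thesis by (simp add: uv \<psi> parameter_map_def sum_diff)
  qed
  have plus_V: "plus_range V = G ` ?T" and minus_V: "minus_range V = H ` ?S"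
    unfolding V_def plus_range_def minus_range_def image_image
    by (auto simp: \<psi> sum_diff case_prod_unfold intro!: image_cong)
  have "open V"
  proof -
    define W where "W = {x. fst x + snd x \<in> G ` ?T \<and> fst x - snd x \<in> H ` ?S}"
    have W: "open W"
      unfolding W_def Collect_conj_eq using p(1) q(1)
      by (intro open_Int open_vimage[unfolded vimage_def] continuous_intros)
    have W_range: "plus_range W \<subseteq> G ` ?T" "minus_range W \<subseteq> H ` ?S"
      by (auto simp: W_def plus_range_def minus_range_def)
    have cont: "continuous_on W (parameter_map p q)"
    proof -
      have "continuous_on W (\<lambda>x. p (fst x + snd x))" "continuous_on W (\<lambda>x. q (fst x - snd x))"
        by (rule continuous_on_compose2[OF smooth_on_imp_continuous_on[OF p(3)]]
            continuous_on_compose2[OF smooth_on_imp_continuous_on[OF q(3)]];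
            auto intro!: continuous_intros simp: W_def)+
      then show ?thesis
        unfolding parameter_map_def case_prod_unfold by (intro continuous_intros)
    qed
    \<comment> \<open>On \<open>W\<close> the functions \<open>p\<close> and \<open>q\<close> are evaluated only where they invert \<open>G\<close> and \<open>H\<close>.\<close>
    have "V = W \<inter> parameter_map p q -` U"
    proof (intro equalityI subsetI)
      fix x assume "x \<in> V"
      then obtain u v where "(u, v) \<in> U" "x = \<psi> (u, v)" unfolding V_def by auto
      then show "x \<in> W \<inter> parameter_map p q -` U"
        using left_inverse[of "(u, v)"] plus_rangeI minus_rangeI by (simp add: W_def \<psi> sum_diff)
    next
      fix x assume x: "x \<in> W \<inter> parameter_map p q -` U"
      then obtain t s where ts: "t \<in> ?T" "s \<in> ?S" "fst x + snd x = G t" "fst x - snd x = H s"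
        unfolding W_def by auto
      have "fst x = (G t + H s) / 2" "snd x = (G t - H s) / 2"
        unfolding ts(3,4)[symmetric] by simp_all
      then have x_eq: "x = ((G t + H s) / 2, (G t - H s) / 2)" by (simp add: prod_eq_iff)
      have "p (G t) = t / 2" "q (H s) = s / 2" using p(4)[OF ts(1)] q(4)[OF ts(2)] by auto
      then have "parameter_map p q x = ((t + s) / 2, (t - s) / 2)"
        by (simp add: x_eq parameter_map_def sum_diff add_divide_distrib diff_divide_distrib)
      moreover have "\<psi> ((t + s) / 2, (t - s) / 2) = x" by (simp add: \<psi> sum_diff x_eq)
      ultimately show "x \<in> V" using x unfolding V_def by (metis IntD2 vimageD image_eqI)
    qed
    then show ?thesis using continuous_open_preimage[OF cont W domain(1)] by simp
  qed
  have smooth_pq: "smooth_on (plus_range V) p" "smooth_on (minus_range V) q"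
    using p(3) q(3) by (simp_all add: plus_V minus_V)
  have bij: "bij_betw (parameter_map p q) V U"
    by (rule bij_betw_byWitness[where f' = \<psi>]) (auto simp: V_def left_inverse)
  have inverse: "inv_into V (parameter_map p q) x = \<psi> x" if "x \<in> U" for x
    using bij that by (intro inv_into_f_eq) (auto simp: bij_betw_def V_def left_inverse)
  have "smooth_on U \<psi>"
    unfolding \<psi>_def using p(2) q(2) T S domain(1)
    by (intro smooth_on_parameter_map smooth_on_mult smooth_on_const)
  then have "smooth_on U (inv_into V (parameter_map p q))"
    using smooth_on_cong[OF _ domain(1)] inverse by metis
  then have change: "change_of_parameters V U (parameter_map p q)"
    using smooth_on_parameter_map[OF \<open>open V\<close> smooth_pq] \<open>open V\<close> domain(1) bij
    by (simp add: change_of_parameters_def)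
  have "canonical_representation V (\<Psi> \<circ> parameter_map p q)
      (\<lambda>z. g1 (2 * p z)) (\<lambda>z. h1 (2 * p z)) (\<lambda>z. g2 (2 * q z)) (\<lambda>z. h2 (2 * q z))"
    unfolding iff[OF smooth_pq change] plus_V minus_V using p(5,6) q(5,6) by blast
  then show ?thesis using iff smooth_pq change by blast
qed

end
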